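(* Let $f$ be a rational map of degree $d\ge 2$ on the Riemann sphere $\widehat{\mathbb{C}}$, and let $\mu_f$ be the measure constructed by Freire--Lopes--Mañé and Lyubich. Then, for every $\phi\in L^1(\mu_f)$, \[ \lim_{n\to\infty}\frac{1}{n}\sum_{j=0}^{n-1}\ \sum^{\prime}_{y\in f^{-j}(x)}\frac{\phi(y)}{d^j}=\int_{\widehat{\mathbb{C}}}\phi\,d\mu_f \] for $\mu_f$-almost every $x\in\widehat{\mathbb{C}}$.
   Context: $f^{-j}(x)$ denotes the set of preimages of $x$ under the $j$-th iterate $f^j$, and $\sum^{\prime}_{y\in f^{-j}(x)}$ is the sum over these preimages repeated according to multiplicity (the local degree of $f^j$ at $y$), so that there are $d^j$ terms; for $j=0$ the sum is $\phi(x)$. The Freire--Lopes--Mañé--Lyubich measure $\mu_f$ of a rational map $f$ of degree $d\ge2$ is the Borel probability measure on $\widehat{\mathbb{C}}$ that is the weak* limit, as $n\to\infty$, of $d^{-n}\sum^{\prime}_{y\in f^{-n}(a)}\delta_y$ for every $a\in\widehat{\mathbb{C}}$ outside an exceptional set of at most two points; equivalently it is the weak* limit of $d^{-n}(f^n)^*\omega$, where $\omega$ is the Fubini--Study form normalised to have total mass $1$. *)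

theory Defs
  imports
    "HOL-Complex_Analysis.Complex_Analysis"
    "HOL-Probability.Probability"
begin

text \<open>The Riemann sphere is the one-point compactification of the complex plane, with
  \<^const>\<open>None\<close> as the point at infinity.\<close>

type_synonym rsphere = "complex option"

definition rsphere_top :: "rsphere topology" where
  "rsphere_top = Alexandroff_compactification euclidean"

definition rsphere_borel :: "rsphere measure" where
  "rsphere_borel = sigma UNIV {U. openin rsphere_top U}"

text \<open>The self-map of the sphere given by \<open>p / q\<close>. It is meaningful for coprime \<open>p\<close> and \<open>q\<close>;
  with \<open>m = max (degree p) (degree q)\<close> the value at infinity is then the quotient of the
  coefficients of index \<open>m\<close>, which do not both vanish.\<close>

definition ratfun :: "complex poly \<Rightarrow> complex poly \<Rightarrow> rsphere \<Rightarrow> rsphere" where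
  "ratfun p q x = (case x of
      Some z \<Rightarrow> if poly q z = 0 then None else Some (poly p z / poly q z)
    | None \<Rightarrow> (let m = max (degree p) (degree q) in
        if coeff q m = 0 then None else Some (coeff p m / coeff q m)))"

definition rational_map :: "nat \<Rightarrow> (rsphere \<Rightarrow> rsphere) \<Rightarrow> bool" where
  "rational_map d f \<longleftrightarrow> (\<exists>p q. q \<noteq> 0 \<and> coprime p q \<and>
     d = max (degree p) (degree q) \<and> f = ratfun p q)"

text \<open>A holomorphic coordinate near \<open>a\<close> vanishing at \<open>a\<close>, and its local inverse. Only the
  values of \<open>rsphere_coord a\<close> near \<open>a\<close> matter (those at the remaining point, infinity or
  \<open>0\<close>, are dummies).\<close>

definition rsphere_coord :: "rsphere \<Rightarrow> rsphere \<Rightarrow> complex" where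
  "rsphere_coord a x = (case a of
      Some c \<Rightarrow> (case x of Some z \<Rightarrow> z - c | None \<Rightarrow> 0)
    | None \<Rightarrow> (case x of Some z \<Rightarrow> inverse z | None \<Rightarrow> 0))"

definition rsphere_param :: "rsphere \<Rightarrow> complex \<Rightarrow> rsphere" where
  "rsphere_param a w = (case a of
      Some c \<Rightarrow> Some (c + w)
    | None \<Rightarrow> if w = 0 then None else Some (inverse w))"

text \<open>The local degree of a non-constant holomorphic map \<open>g\<close> at \<open>a\<close>: the order of the zero at
  \<open>0\<close> of \<open>g\<close> written in coordinates centred at \<open>a\<close> and \<open>g a\<close>.\<close>

definition local_degree :: "(rsphere \<Rightarrow> rsphere) \<Rightarrow> rsphere \<Rightarrow> nat" where
  "local_degree g a = nat (zorder (\<lambda>w. rsphere_coord (g a) (g (rsphere_param a w))) 0)"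

definition preimage_sum ::
    "(rsphere \<Rightarrow> rsphere) \<Rightarrow> (rsphere \<Rightarrow> 'b::real_vector) \<Rightarrow> rsphere \<Rightarrow> 'b" where
  "preimage_sum g \<phi> x = (\<Sum>y\<in>g -` {x}. real (local_degree g y) *\<^sub>R \<phi> y)"

text \<open>\<open>\<mu>\<close> is the Freire--Lopes--Mane--Lyubich measure of the rational map \<open>f\<close> of degree \<open>d\<close>:
  the weak* limit of the normalised preimage measures of every base point outside an
  exceptional set of at most two points. This determines \<open>\<mu>\<close> uniquely.\<close>

definition FLML_measure :: "nat \<Rightarrow> (rsphere \<Rightarrow> rsphere) \<Rightarrow> rsphere measure \<Rightarrow> bool" where
  "FLML_measure d f \<mu> \<longleftrightarrow>
     prob_space \<mu> \<and> sets \<mu> = sets rsphere_borel \<and>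
     (\<exists>E. finite E \<and> card E \<le> 2 \<and>
        (\<forall>a. a \<notin> E \<longrightarrow>
          (\<forall>\<psi> :: rsphere \<Rightarrow> real. continuous_map rsphere_top euclideanreal \<psi> \<longrightarrow>
            (\<lambda>n. preimage_sum (f ^^ n) \<psi> a / real d ^ n) \<longlonglongrightarrow> (\<integral>y. \<psi> y \<partial>\<mu>))))"

end

theory Submission
  imports Defs "HOL-Computational_Algebra.Fundamental_Theorem_Algebra"
begin

text \<open>The normalised preimage sum \<open>T\<close> is a positive operator with \<open>T 1 = 1\<close>. It maps continuous
  functions to continuous ones (continuity of roots), so \<open>T\<^sup>n\<^sup>+\<^sup>1 \<psi> = T\<^sup>n (T \<psi>)\<close> and the definition
  of \<open>\<mu>\<close> as a weak* limit give \<open>\<integral> T \<psi> d\<mu> = \<integral> \<psi> d\<mu>\<close>. Hence \<open>T\<close> contracts \<open>L\<^sup>1(\<mu>)\<close> and Hopf's maximal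
  ergodic inequality applies. For continuous \<open>\<psi>\<close> the iterates \<open>T\<^sup>n \<psi>\<close> converge to \<open>\<integral> \<psi> d\<mu>\<close> off the
  finite exceptional set, which is \<open>\<mu>\<close>-null because \<open>\<mu>\<close> has no atoms: atoms of maximal mass would be
  superattracting, and preimages of points outside their basins stay away from them. Density of the
  continuous functions in \<open>L\<^sup>1(\<mu>)\<close> concludes.\<close>

section \<open>Markov operators and the maximal ergodic theorem\<close>

text \<open>The obstacle is that \<open>T\<close> sums over a fibre that moves with the point, so
  neither continuity nor even measurability of \<open>T g\<close> can be read off the formula.
  Continuity: near x the fibre over the point with coordinate u is the zero set of a polynomial A -
  u B, the missing degree being the multiplicity of infinity, and Rouche's theorem follows the
  zeros. Measurability: the normalised multiplicities form a Markov kernel K, which needs testing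
  only on a generator of the Borel sets; equality of integrals for continuous functions then extends
  to the identity \<mu> K = \<mu> between measures. That the iterates of \<open>T\<close> are the
  normalised preimage sums of the iterates of f rests on the multiplicativity of local degrees, for
  which a local normal form in charts is used. The value of the limit is settled on continuous
  functions, where the iterates themselves converge, not only their averages. Weak convergence is
  given only at base points outside the exceptional set, so an atom of \<mu> inside that set would
  spoil the statement for almost every x; this is why atoms have to be excluded.\<close>

lemma Cesaro_mean_tendsto:
  fixes a :: "nat \<Rightarrow> real"
  assumes "a \<longlonglongrightarrow> L"
  shows "(\<lambda>n. (\<Sum>j<n. a j) / n) \<longlonglongrightarrow> L"
proof (rule LIMSEQ_I)
  fix e :: real assume "e > 0"
  then obtain N where N: "\<And>j. j \<ge> N \<Longrightarrow> \<bar>a j - L\<bar> < e / 2"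
    using LIMSEQ_D[OF assms, of "e / 2"] by auto
  define C where "C = (\<Sum>j<N. \<bar>a j - L\<bar>)"
  have "C \<ge> 0" by (simp add: C_def sum_nonneg)
  obtain K :: nat where K: "2 * C / e < K" using reals_Archimedean2 by blast
  show "\<exists>no. \<forall>n\<ge>no. norm ((\<Sum>j<n. a j) / n - L) < e"
  proof (intro exI allI impI)
    fix n assume n: "n \<ge> max (Suc N) K"
    have pos: "real n > 0" using n by auto
    have "\<bar>(\<Sum>j<n. a j) - n * L\<bar> = \<bar>\<Sum>j<n. a j - L\<bar>" by (simp add: sum_subtractf)
    also have "\<dots> \<le> (\<Sum>j<n. \<bar>a j - L\<bar>)" by (rule sum_abs)
    also have "\<dots> = C + (\<Sum>j=N..<n. \<bar>a j - L\<bar>)"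
      unfolding C_def using n by (subst sum.atLeastLessThan_concat[of 0 N n, symmetric, unfolded lessThan_atLeast0[symmetric]])
        auto
    also have "(\<Sum>j=N..<n. \<bar>a j - L\<bar>) \<le> (\<Sum>j=N..<n. e / 2)"
      by (intro sum_mono less_imp_le[OF N]) auto
    also have "\<dots> \<le> n * (e / 2)" using \<open>e > 0\<close> by (simp add: mult_right_mono)
    finally have 1: "\<bar>(\<Sum>j<n. a j) - n * L\<bar> \<le> C + n * (e / 2)" by simp
    have "2 * C / e < n" using K n by (meson max.bounded_iff of_nat_le_iff order_less_le_trans)
    then have "C < n * (e / 2)" using \<open>e > 0\<close> by (simp add: field_simps)
    with 1 have 2: "\<bar>(\<Sum>j<n. a j) - n * L\<bar> < n * e" by simp
    have "(\<Sum>j<n. a j) / n - L = ((\<Sum>j<n. a j) - n * L) / n" using pos by (simp add: field_simps)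
    then have "\<bar>(\<Sum>j<n. a j) / n - L\<bar> = \<bar>(\<Sum>j<n. a j) - n * L\<bar> / n" by (simp add: abs_divide)
    also have "\<dots> < e" using 2 pos by (simp add: field_simps)
    finally show "norm ((\<Sum>j<n. a j) / n - L) < e" by simp
  qed
qed

text \<open>The intended \<open>T\<close> is a finite weighted sum over a fibre, so linearity and
  monotonicity hold at every point and for every function, measurable or not. Stating them so,
  instead of modulo null sets, makes \<open>(T ^^ n) f x\<close> meaningful at a single x and keeps
  the algebra free of side conditions.\<close>

locale markov_operator = prob_space M for M :: "'a measure" +
  fixes T :: "('a \<Rightarrow> real) \<Rightarrow> 'a \<Rightarrow> real"
  assumes T_add: "T (\<lambda>x. f x + g x) = (\<lambda>x. T f x + T g x)"
    and T_scale: "T (\<lambda>x. c * f x) = (\<lambda>x. c * T f x)"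
    and T_one: "T (\<lambda>x. 1) = (\<lambda>x. 1)"
    and T_mono: "(\<And>x. f x \<le> g x) \<Longrightarrow> T f x \<le> T g x"
    and T_integrable: "integrable M f \<Longrightarrow> integrable M (T f)"
    and T_integral: "integrable M f \<Longrightarrow> (\<integral>x. T f x \<partial>M) = (\<integral>x. f x \<partial>M)"
begin

lemma T_const: "T (\<lambda>x. c) = (\<lambda>x. c)"
  using T_scale[of c "\<lambda>x. 1"] by (simp add: T_one)

lemma T_diff: "T (\<lambda>x. f x - g x) = (\<lambda>x. T f x - T g x)"
  using T_add[of f "\<lambda>x. -1 * g x"] by (simp only: T_scale) simp

lemma T_sum: "T (\<lambda>x. \<Sum>j<n. F j x) = (\<lambda>x. \<Sum>j<n. T (F j) x)" for n :: nat
  by (induction n) (simp_all add: T_const T_add)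

definition birkhoff_sum :: "nat \<Rightarrow> ('a \<Rightarrow> real) \<Rightarrow> 'a \<Rightarrow> real" where
  "birkhoff_sum n f x = (\<Sum>j<n. (T ^^ j) f x)"

lemma birkhoff_sum_Suc: "birkhoff_sum (Suc n) f x = f x + T (birkhoff_sum n f) x"
proof -
  have "birkhoff_sum (Suc n) f x = f x + (\<Sum>j<n. (T ^^ Suc j) f x)"
    unfolding birkhoff_sum_def by (subst sum.lessThan_Suc_shift) simp
  also have "(\<Sum>j<n. (T ^^ Suc j) f x) = T (birkhoff_sum n f) x"
    unfolding birkhoff_sum_def by (simp add: T_sum)
  finally show ?thesis .
qed

lemma funpow_T_diff: "(T ^^ j) (\<lambda>x. f x - g x) = (\<lambda>x. (T ^^ j) f x - (T ^^ j) g x)"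
  by (induction j) (simp_all add: T_diff)

lemma funpow_T_const: "(T ^^ j) (\<lambda>x. c) = (\<lambda>x. c)"
  by (induction j) (simp_all add: T_const)

lemma funpow_T_mono: "(\<And>x. f x \<le> g x) \<Longrightarrow> (T ^^ j) f x \<le> (T ^^ j) g x"
  by (induction j arbitrary: x) (auto intro!: T_mono)

lemma abs_funpow_T_le: "\<bar>(T ^^ j) f x\<bar> \<le> (T ^^ j) (\<lambda>x. \<bar>f x\<bar>) x"
proof -
  have "(T ^^ j) (\<lambda>x. 0 - \<bar>f x\<bar>) x \<le> (T ^^ j) f x" by (rule funpow_T_mono) auto
  moreover have "(T ^^ j) f x \<le> (T ^^ j) (\<lambda>x. \<bar>f x\<bar>) x" by (rule funpow_T_mono) auto
  moreover have "(T ^^ j) (\<lambda>x. 0 - \<bar>f x\<bar>) x = - (T ^^ j) (\<lambda>x. \<bar>f x\<bar>) x"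
    by (simp only: funpow_T_diff funpow_T_const)
  ultimately show ?thesis by linarith
qed

lemma birkhoff_sum_diff: "birkhoff_sum n (\<lambda>x. f x - g x) x = birkhoff_sum n f x - birkhoff_sum n g x"
  by (simp add: birkhoff_sum_def funpow_T_diff sum_subtractf)

lemma birkhoff_sum_const: "birkhoff_sum n (\<lambda>x. c) x = c * n"
  by (simp add: birkhoff_sum_def funpow_T_const)

lemma abs_birkhoff_sum_le: "\<bar>birkhoff_sum n f x\<bar> \<le> birkhoff_sum n (\<lambda>x. \<bar>f x\<bar>) x"
  unfolding birkhoff_sum_def by (rule order_trans[OF sum_abs]) (intro sum_mono abs_funpow_T_le)

text \<open>Garsia's recursion: \<open>garsia f n\<close> is a majorant of \<open>birkhoff_sum k f\<close> for all \<open>k \<le> n\<close> that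
  satisfies \<open>garsia f n \<le> f + T (garsia f n)\<close> wherever it is positive.\<close>

primrec garsia :: "('a \<Rightarrow> real) \<Rightarrow> nat \<Rightarrow> 'a \<Rightarrow> real" where
  "garsia f 0 = (\<lambda>x. 0)"
| "garsia f (Suc n) = (\<lambda>x. max 0 (f x + T (garsia f n) x))"

lemma garsia_nonneg: "0 \<le> garsia f n x"
  by (cases n) auto

lemma garsia_le_Suc: "garsia f n x \<le> garsia f (Suc n) x"
proof (induction n arbitrary: x)
  case (Suc n)
  show ?case using T_mono[of "garsia f n" "garsia f (Suc n)" x] Suc by auto
qed simp

lemma birkhoff_sum_le_garsia: "birkhoff_sum n f x \<le> garsia f n x"
proof (induction n arbitrary: x)
  case 0
  show ?case by (simp add: birkhoff_sum_def)
next
  case (Suc n)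
  show ?case using T_mono[of "birkhoff_sum n f" "garsia f n" x] Suc by (auto simp: birkhoff_sum_Suc)
qed

lemma integrable_garsia: "integrable M f \<Longrightarrow> integrable M (garsia f n)"
  by (induction n) (auto intro!: Bochner_Integration.integrable_max T_integrable Bochner_Integration.integrable_add)

text \<open>Write G for \<open>garsia f n\<close>. By invariance G - T G has integral 0. Pointwise
  it is at most f where G > 0, by the recursion and \<open>garsia_le_Suc\<close>, and at most 0
  where G = 0, because T G is nonnegative.\<close>

lemma maximal_ergodic:
  assumes f: "integrable M f"
  shows "0 \<le> (\<integral>x. indicator {x \<in> space M. garsia f n x > 0} x * f x \<partial>M)"
proof -
  note g = integrable_garsia[OF f, of n]
  have [measurable]: "garsia f n \<in> borel_measurable M" using g by simp
  have "0 = (\<integral>x. garsia f n x - T (garsia f n) x \<partial>M)"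
    using g by (simp add: T_integrable T_integral)
  also have "\<dots> \<le> (\<integral>x. indicator {x \<in> space M. garsia f n x > 0} x * f x \<partial>M)"
  proof (rule integral_mono)
    show "integrable M (\<lambda>x. indicator {x \<in> space M. 0 < garsia f n x} x * f x)"
      using integrable_mult_indicator[OF _ f, of "{x \<in> space M. 0 < garsia f n x}"] by simp
  next
    fix x assume x: "x \<in> space M"
    show "garsia f n x - T (garsia f n) x \<le> indicator {x \<in> space M. 0 < garsia f n x} x * f x"
    proof (cases "garsia f n x > 0")
      case True
      with garsia_le_Suc[of f n x] show ?thesis using x by auto
    next
      case False
      then have "garsia f n x = 0" using garsia_nonneg[of f n x] by auto
      moreover have "0 \<le> T (garsia f n) x"
        using T_mono[of "\<lambda>x. 0" "garsia f n" x] garsia_nonneg by (simp add: T_const)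
      ultimately show ?thesis by simp
    qed
  qed (use g in \<open>auto intro: T_integrable\<close>)
  finally show ?thesis .
qed

text \<open>The weak type bound results from applying \<open>maximal_ergodic\<close> to f - c. The
  sets where its Garsia functions are positive increase with n, so their union A serves all n at
  once: off A every Birkhoff sum of f - c is at most 0.\<close>

lemma maximal_inequality:
  assumes f: "integrable M f" and nonneg: "\<And>x. 0 \<le> f x" and c: "c > 0"
  obtains A where "A \<in> sets M" "measure M A \<le> (\<integral>x. f x \<partial>M) / c"
    "\<And>x n. x \<in> space M - A \<Longrightarrow> birkhoff_sum n f x \<le> c * n"
proof -
  define g where "g x = f x - c" for x
  have g: "integrable M g" unfolding g_def using f by simp
  have [measurable]: "garsia g n \<in> borel_measurable M" for n using integrable_garsia[OF g, of n] by simp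
  have [measurable]: "f \<in> borel_measurable M" using f by simp
  define A where "A n = {x \<in> space M. garsia g n x > 0}" for n
  have A[measurable]: "A n \<in> sets M" for n unfolding A_def by measurable
  have inc: "incseq A"
    using garsia_le_Suc by (intro incseq_SucI) (force simp: A_def intro: order_less_le_trans)
  have "c * measure M (A n) \<le> (\<integral>x. f x \<partial>M)" for n
  proof -
    have int: "integrable M (\<lambda>x. indicator (A n) x * f x)"
      using integrable_mult_indicator[OF A f] by simp
    have "0 \<le> (\<integral>x. indicator (A n) x * g x \<partial>M)"
      using maximal_ergodic[OF g] by (simp add: A_def)
    also have "\<dots> = (\<integral>x. indicator (A n) x * f x - c * indicator (A n) x \<partial>M)"
      by (intro Bochner_Integration.integral_cong) (auto simp: g_def algebra_simps)
    also have "\<dots> = (\<integral>x. indicator (A n) x * f x \<partial>M) - c * measure M (A n)"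
      using int by (subst Bochner_Integration.integral_diff) (auto simp: less_top[symmetric])
    also have "(\<integral>x. indicator (A n) x * f x \<partial>M) \<le> (\<integral>x. f x \<partial>M)"
      using int f nonneg by (intro integral_mono) (auto simp: indicator_def)
    finally show ?thesis by simp
  qed
  then have "measure M (A n) \<le> (\<integral>x. f x \<partial>M) / c" for n
    using c by (simp add: field_simps)
  moreover have "(\<lambda>n. measure M (A n)) \<longlonglongrightarrow> measure M (\<Union>n. A n)"
    using inc by (intro finite_Lim_measure_incseq) auto
  ultimately have "measure M (\<Union>n. A n) \<le> (\<integral>x. f x \<partial>M) / c"
    by (intro LIMSEQ_le_const2) auto
  moreover have "birkhoff_sum n f x \<le> c * n" if "x \<in> space M - (\<Union>n. A n)" for x n
  proof -
    have "birkhoff_sum n g x \<le> 0"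
      using order_trans[OF birkhoff_sum_le_garsia[of n g x]] that by (auto simp: A_def not_less)
    then show ?thesis unfolding g_def birkhoff_sum_diff birkhoff_sum_const by simp
  qed
  ultimately show ?thesis by (intro that[of "\<Union>n. A n"]) auto
qed

text \<open>Banach's principle: by the maximal inequality the a.e. convergence of the averages
  passes from an \<open>L\<^sup>1\<close>-dense class to all integrable functions.\<close>

theorem birkhoff_averages_AE_tendsto:
  fixes D :: "('a \<Rightarrow> real) set"
  assumes D: "\<And>\<psi>. \<psi> \<in> D \<Longrightarrow> integrable M \<psi>"
    and conv: "\<And>\<psi>. \<psi> \<in> D \<Longrightarrow> AE x in M. (\<lambda>n. (T ^^ n) \<psi> x) \<longlonglongrightarrow> (\<integral>x. \<psi> x \<partial>M)"
    and dense: "\<And>f e. integrable M f \<Longrightarrow> e > 0 \<Longrightarrow> \<exists>\<psi>\<in>D. (\<integral>x. \<bar>f x - \<psi> x\<bar> \<partial>M) < e"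
    and f: "integrable M f"
  shows "AE x in M. (\<lambda>n. birkhoff_sum n f x / n) \<longlonglongrightarrow> (\<integral>x. f x \<partial>M)"
proof -
  \<comment> \<open>An L1 error below \<open>\<epsilon> k * \<epsilon> k\<close>, tested at level
    \<open>\<epsilon> k\<close>, leaves a bad set of measure at most \<open>\<epsilon> k\<close>; a
    geometric sequence makes these measures summable for Borel-Cantelli.\<close>
  define \<epsilon> :: "nat \<Rightarrow> real" where "\<epsilon> k = (1/2) ^ k" for k
  have \<epsilon>: "\<epsilon> k > 0" for k by (simp add: \<epsilon>_def)
  have "\<forall>k. \<exists>\<psi>\<in>D. (\<integral>x. \<bar>f x - \<psi> x\<bar> \<partial>M) < \<epsilon> k * \<epsilon> k"
    using dense[OF f] \<epsilon> by simp
  then obtain \<psi> :: "nat \<Rightarrow> 'a \<Rightarrow> real" where \<psi>: "\<And>k. \<psi> k \<in> D" "\<And>k. (\<integral>x. \<bar>f x - \<psi> k x\<bar> \<partial>M) < \<epsilon> k * \<epsilon> k"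
    unfolding Bex_def by (auto dest!: choice)
  have int: "integrable M (\<lambda>x. \<bar>f x - \<psi> k x\<bar>)" for k
    using f D[OF \<psi>(1)] by auto
  have "\<forall>k. \<exists>A. A \<in> sets M \<and> measure M A \<le> \<epsilon> k \<and>
      (\<forall>x\<in>space M - A. \<forall>n. birkhoff_sum n (\<lambda>x. \<bar>f x - \<psi> k x\<bar>) x \<le> \<epsilon> k * n)"
  proof
    fix k
    obtain A where A: "A \<in> sets M" "measure M A \<le> (\<integral>x. \<bar>f x - \<psi> k x\<bar> \<partial>M) / \<epsilon> k"
      "\<And>x n. x \<in> space M - A \<Longrightarrow> birkhoff_sum n (\<lambda>x. \<bar>f x - \<psi> k x\<bar>) x \<le> \<epsilon> k * n"
      using maximal_inequality[OF int abs_ge_zero \<epsilon>] by blast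
    have "(\<integral>x. \<bar>f x - \<psi> k x\<bar> \<partial>M) / \<epsilon> k \<le> \<epsilon> k"
      using \<psi>(2)[of k] \<epsilon>[of k] by (simp add: field_simps)
    with A show "\<exists>A. A \<in> sets M \<and> measure M A \<le> \<epsilon> k \<and>
      (\<forall>x\<in>space M - A. \<forall>n. birkhoff_sum n (\<lambda>x. \<bar>f x - \<psi> k x\<bar>) x \<le> \<epsilon> k * n)"
      by (intro exI[of _ A]) auto
  qed
  then obtain A where A: "\<And>k. A k \<in> sets M" "\<And>k. measure M (A k) \<le> \<epsilon> k"
      "\<And>k x n. x \<in> space M - A k \<Longrightarrow> birkhoff_sum n (\<lambda>x. \<bar>f x - \<psi> k x\<bar>) x \<le> \<epsilon> k * n"
    by (auto dest!: choice)
  have "summable \<epsilon>" unfolding \<epsilon>_def by (rule summable_geometric) simp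
  then have "summable (\<lambda>k. measure M (A k))"
    by (rule summable_comparison_test') (use A(2) in auto)
  \<comment> \<open>Almost every x avoids \<open>A k\<close> for all large k. Hence k may be chosen
    after e and x, with the maximal bound and the convergence for \<open>\<psi> k\<close> both
    available at x.\<close>
  then have "AE x in M. eventually (\<lambda>k. x \<in> space M - A k) sequentially"
    by (intro borel_cantelli_AE1) (use A(1) in \<open>auto simp: less_top[symmetric]\<close>)
  moreover have "AE x in M. \<forall>k. (\<lambda>n. (T ^^ n) (\<psi> k) x) \<longlonglongrightarrow> (\<integral>x. \<psi> k x \<partial>M)"
    using conv[OF \<psi>(1)] by (subst AE_all_countable) auto
  ultimately show ?thesis
  proof eventually_elim
    case (elim x)
    show ?case
    proof (rule LIMSEQ_I)
      fix e :: real assume "e > 0"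
      have "\<epsilon> \<longlonglongrightarrow> 0" unfolding \<epsilon>_def by (rule LIMSEQ_power_zero) simp
      \<comment> \<open>Three errors share e: between the averages of f and of
        \<open>\<psi> k\<close>, between the latter and the integral of \<open>\<psi> k\<close>, and
        between the two integrals. The bound 1 serves to estimate
        \<open>\<epsilon> k * \<epsilon> k\<close> by \<open>\<epsilon> k\<close> in the
        third.\<close>
      then have "eventually (\<lambda>k. \<epsilon> k < min 1 (e / 3)) sequentially"
        using \<open>e > 0\<close> by (intro order_tendstoD) auto
      with elim(1) have "eventually (\<lambda>k. x \<in> space M - A k \<and> \<epsilon> k < min 1 (e / 3)) sequentially"
        by (rule eventually_conj)
      then obtain k where k: "x \<in> space M - A k" "\<epsilon> k < 1" "\<epsilon> k < e / 3"
        using eventually_happens by force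
      have lim: "(\<lambda>n. birkhoff_sum n (\<psi> k) x / n) \<longlonglongrightarrow> (\<integral>x. \<psi> k x \<partial>M)"
        unfolding birkhoff_sum_def using elim(2) by (intro Cesaro_mean_tendsto) auto
      obtain N where N: "\<And>n. n \<ge> N \<Longrightarrow> \<bar>birkhoff_sum n (\<psi> k) x / n - (\<integral>x. \<psi> k x \<partial>M)\<bar> < e / 3"
        using LIMSEQ_D[OF lim, of "e / 3"] \<open>e > 0\<close> by auto
      have i: "\<bar>(\<integral>x. \<psi> k x \<partial>M) - (\<integral>x. f x \<partial>M)\<bar> < e / 3"
      proof -
        have "\<bar>(\<integral>x. f x - \<psi> k x \<partial>M)\<bar> \<le> (\<integral>x. \<bar>f x - \<psi> k x\<bar> \<partial>M)"
          by (rule integral_abs_bound)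
        moreover have "(\<integral>x. f x - \<psi> k x \<partial>M) = (\<integral>x. f x \<partial>M) - (\<integral>x. \<psi> k x \<partial>M)"
          using f D[OF \<psi>(1)] by (rule Bochner_Integration.integral_diff)
        moreover have "\<epsilon> k * \<epsilon> k \<le> 1 * \<epsilon> k" using k \<epsilon>[of k] by (intro mult_right_mono) auto
        ultimately show ?thesis using \<psi>(2)[of k] k(3) by linarith
      qed
      show "\<exists>no. \<forall>n\<ge>no. norm (birkhoff_sum n f x / n - (\<integral>x. f x \<partial>M)) < e"
      proof (intro exI[of _ "max 1 N"] allI impI)
        fix n assume n: "n \<ge> max 1 N"
        have "\<bar>birkhoff_sum n f x - birkhoff_sum n (\<psi> k) x\<bar> \<le> \<epsilon> k * n"
          using abs_birkhoff_sum_le[of n "\<lambda>x. f x - \<psi> k x" x] A(3)[OF k(1), of n]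
          by (simp add: birkhoff_sum_diff)
        then have "\<bar>birkhoff_sum n f x / n - birkhoff_sum n (\<psi> k) x / n\<bar> \<le> \<epsilon> k"
          using n by (simp add: diff_divide_distrib[symmetric] abs_divide field_simps)
        with N[of n] i n k(3) show "norm (birkhoff_sum n f x / n - (\<integral>x. f x \<partial>M)) < e"
          unfolding real_norm_def by linarith
      qed
    qed
  qed
qed

end

section \<open>Topology and Borel structure of the Riemann sphere\<close>

lemma rsphere_param_0 [simp]: "rsphere_param x 0 = x"
  by (auto simp: rsphere_param_def split: option.splits)

lemma rsphere_coord_param [simp]: "rsphere_coord x (rsphere_param x w) = w"
  by (auto simp: rsphere_param_def rsphere_coord_def split: option.splits)

lemma topspace_rsphere_top [simp]: "topspace rsphere_top = UNIV"
  by (auto simp: rsphere_top_def) (metis not_None_eq rangeI)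

text \<open>Puts infinity on the same footing as the finite points: all later topology is done in
  the charts centred at x. At infinity, containing the complement of a compact set means containing
  all z with norm above some B, which is the disc of radius 1 / B in the chart.\<close>

lemma openin_rsphere_top_iff:
  "openin rsphere_top U \<longleftrightarrow> (\<forall>x\<in>U. \<forall>\<^sub>F w in nhds 0. rsphere_param x w \<in> U)"
proof
  assume "openin rsphere_top U"
  then consider (fin) V where "open V" "U = Some ` V"
    | (inf) C where "compact C" "U = insert None (Some ` (- C))"
    unfolding rsphere_top_def openin_Alexandroff_compactification
    by (auto simp: Compl_eq_Diff_UNIV)
  then show "\<forall>x\<in>U. \<forall>\<^sub>F w in nhds 0. rsphere_param x w \<in> U"
  proof cases
    case fin
    have "\<forall>\<^sub>F w in nhds 0. c + w \<in> V" if "c \<in> V" for c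
      using fin(1) that by (intro topological_tendstoD[where l = c] tendsto_eq_intros) (auto intro: filterlim_ident)
    with fin(2) show ?thesis by (auto simp: rsphere_param_def inj_image_mem_iff)
  next
    case inf
    have "\<forall>\<^sub>F w in nhds 0. c + w \<in> - C" if "c \<in> - C" for c
      using inf(1) that
      by (intro topological_tendstoD[where l = c] tendsto_eq_intros)
        (auto intro: compact_imp_closed filterlim_ident)
    from eventually_mono[OF this]
    have 1: "\<forall>\<^sub>F w in nhds 0. rsphere_param (Some c) w \<in> U" if "c \<in> - C" for c
      using that by (auto simp: rsphere_param_def inf(2))
    obtain B where B: "B > 0" "\<And>z. z \<in> C \<Longrightarrow> norm z \<le> B"
      using compact_imp_bounded[OF inf(1)] by (auto simp: bounded_pos)
    have "rsphere_param None w \<in> U" if "dist w 0 < 1 / B" for w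
    proof (cases "w = 0")
      case False
      have "inverse w \<notin> C"
      proof
        assume "inverse w \<in> C"
        from B(2)[OF this] show False
          using that False B(1) by (simp add: norm_inverse norm_divide field_simps)
      qed
      then show ?thesis using False by (auto simp: rsphere_param_def inf(2))
    qed (auto simp: inf(2))
    then have 2: "\<forall>\<^sub>F w in nhds 0. rsphere_param None w \<in> U"
      unfolding eventually_nhds_metric using B(1) by (intro exI[of _ "1 / B"]) auto
    from 1 2 show ?thesis by (auto simp: inf(2))
  qed
next
  assume *: "\<forall>x\<in>U. \<forall>\<^sub>F w in nhds 0. rsphere_param x w \<in> U"
  define V where "V = {z. Some z \<in> U}"
  have V: "open V"
  proof (subst open_dist, intro ballI)
    fix c assume "c \<in> V"
    with * obtain r where r: "r > 0" "\<And>w. dist w 0 < r \<Longrightarrow> rsphere_param (Some c) w \<in> U"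
      by (auto simp: V_def eventually_nhds_metric)
    have "z \<in> V" if "dist z c < r" for z
      using r(2)[of "z - c"] that by (auto simp: V_def rsphere_param_def dist_norm)
    with r(1) show "\<exists>e>0. \<forall>z. dist z c < e \<longrightarrow> z \<in> V" by auto
  qed
  show "openin rsphere_top U"
  proof (cases "None \<in> U")
    case False
    then have "U = Some ` V"
      by (auto simp: V_def image_def) (metis not_None_eq)
    with V show ?thesis by (simp add: rsphere_top_def)
  next
    case True
    with * obtain r where r: "r > 0" "\<And>w. dist w 0 < r \<Longrightarrow> rsphere_param None w \<in> U"
      by (auto simp: eventually_nhds_metric)
    have "norm z \<le> 1 / r" if "z \<notin> V" for z
    proof (rule ccontr)
      assume "\<not> norm z \<le> 1 / r"
      then have z: "norm z > 1 / r" by simp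
      then have "z \<noteq> 0" using r(1) by auto
      have "norm (inverse z) < r" using z r(1) \<open>z \<noteq> 0\<close> by (simp add: norm_inverse norm_divide field_simps)
      then have "Some z \<in> U" using r(2)[of "inverse z"] \<open>z \<noteq> 0\<close> by (simp add: rsphere_param_def)
      with that show False by (simp add: V_def)
    qed
    then have "compact (- V)" using V
      by (auto simp: compact_eq_bounded_closed bounded_iff)
    moreover have "U = insert None (Some ` (UNIV - (- V)))"
      using True by (auto simp: V_def image_def)
    ultimately show ?thesis unfolding rsphere_top_def openin_Alexandroff_compactification
      by (intro disjI2 exI[of _ "- V"]) (auto intro: compact_imp_closed)
  qed
qed

lemma continuous_map_rsphere_iff:
  "continuous_map rsphere_top euclidean g \<longleftrightarrow> (\<forall>x. isCont (\<lambda>w. g (rsphere_param x w)) 0)"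
  for g :: "rsphere \<Rightarrow> 'b::topological_space"
proof
  assume L: "continuous_map rsphere_top euclidean g"
  show "\<forall>x. isCont (\<lambda>w. g (rsphere_param x w)) 0"
  proof
    fix x
    have "((\<lambda>w. g (rsphere_param x w)) \<longlongrightarrow> g x) (nhds 0)"
    proof (rule topological_tendstoI)
      fix T :: "'b set" assume "open T" "g x \<in> T"
      with L have "openin rsphere_top {x. g x \<in> T}" by (simp add: continuous_map_def)
      with \<open>g x \<in> T\<close> show "\<forall>\<^sub>F w in nhds 0. g (rsphere_param x w) \<in> T"
        unfolding openin_rsphere_top_iff by auto
    qed
    then show "isCont (\<lambda>w. g (rsphere_param x w)) 0"
      using tendsto_at_iff_tendsto_nhds[of "\<lambda>w. g (rsphere_param x w)" 0] by (simp add: isCont_def)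
  qed
next
  assume R: "\<forall>x. isCont (\<lambda>w. g (rsphere_param x w)) 0"
  have "openin rsphere_top {x. g x \<in> T}" if T: "open T" for T
    unfolding openin_rsphere_top_iff
  proof (intro ballI)
    fix x assume x: "x \<in> {x. g x \<in> T}"
    have "((\<lambda>w. g (rsphere_param x w)) \<longlongrightarrow> g x) (nhds 0)"
      using R[rule_format, of x] tendsto_at_iff_tendsto_nhds[of "\<lambda>w. g (rsphere_param x w)" 0] by (simp add: isCont_def)
    from topological_tendstoD[OF this T] x
    show "\<forall>\<^sub>F w in nhds 0. rsphere_param x w \<in> {x. g x \<in> T}" by auto
  qed
  then show "continuous_map rsphere_top euclidean g"
    by (simp add: continuous_map_def)
qed


lemma Hausdorff_rsphere_top: "Hausdorff_space rsphere_top"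
  unfolding rsphere_top_def Hausdorff_space_Alexandroff_compactification
  by (auto simp: locally_compact_space_euclidean)

lemma compact_rsphere_top: "compact_space rsphere_top"
  by (simp add: rsphere_top_def)

lemma continuous_map_rsphere_bounded:
  fixes \<psi> :: "rsphere \<Rightarrow> real"
  assumes "continuous_map rsphere_top euclideanreal \<psi>"
  obtains B where "\<And>x. \<bar>\<psi> x\<bar> \<le> B"
proof -
  have "compactin euclideanreal (\<psi> ` UNIV)"
    using image_compactin[OF _ assms, of UNIV] compact_rsphere_top by (simp add: compact_space_def)
  then have "bounded (range \<psi>)" by (simp add: compact_imp_bounded)
  then show thesis using that by (auto simp: bounded_iff)
qed

text \<open>A compact Hausdorff space is normal, hence completely regular. The function obtained is
  the test function that will detect a putative atom of \<mu>.\<close>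

lemma rsphere_Urysohn:
  assumes U: "openin rsphere_top U" and x: "x \<in> U"
  obtains \<psi> where "continuous_map rsphere_top euclideanreal \<psi>" "\<And>y. 0 \<le> \<psi> y" "\<psi> x = 1"
    "\<And>y. y \<notin> U \<Longrightarrow> \<psi> y = 0"
proof -
  have "completely_regular_space rsphere_top"
    by (simp add: Hausdorff_rsphere_top compact_rsphere_top compact_Hausdorff_or_regular_imp_normal_space
        normal_imp_completely_regular_space_A Hausdorff_imp_t1_space)
  moreover have "closedin rsphere_top (- U)"
    using U by (simp add: closedin_def Compl_eq_Diff_UNIV[symmetric])
  ultimately obtain g where g: "continuous_map rsphere_top (top_of_set {0..1::real}) g" "g x = 0" "g ` (- U) \<subseteq> {1}"
    unfolding completely_regular_space_def using x by (metis ComplD Diff_iff UNIV_I topspace_rsphere_top)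
  then have "continuous_map rsphere_top euclideanreal g" and g01: "\<And>y. g y \<in> {0..1}"
    by (auto simp: continuous_map_in_subtopology)
  then have "continuous_map rsphere_top euclideanreal (\<lambda>y. 1 - g y)"
    by (intro continuous_intros) auto
  with g g01 show thesis by (intro that[of "\<lambda>y. 1 - g y"]) auto
qed

section \<open>Borel sets of the sphere and density of the continuous functions in L1\<close>

lemma space_rsphere_borel [simp]: "space rsphere_borel = UNIV"
  by (simp add: rsphere_borel_def)

lemma sets_rsphere_borel_open: "openin rsphere_top U \<Longrightarrow> U \<in> sets rsphere_borel"
  by (simp add: rsphere_borel_def)

lemma sets_rsphere_borel_singleton: "{x} \<in> sets rsphere_borel"
proof -
  have "closedin rsphere_top {x}"
    using closedin_Hausdorff_singleton[OF Hausdorff_rsphere_top] by simp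
  then have "- {x} \<in> sets rsphere_borel"
    by (intro sets_rsphere_borel_open) (simp add: closedin_def Compl_eq_Diff_UNIV)
  from sets.compl_sets[OF this] show ?thesis by simp
qed

lemma borel_measurable_rsphere_continuous:
  fixes \<psi> :: "rsphere \<Rightarrow> real"
  assumes "continuous_map rsphere_top euclideanreal \<psi>"
  shows "\<psi> \<in> borel_measurable rsphere_borel"
proof (rule borel_measurableI)
  fix S :: "real set" assume "open S"
  with assms have "openin rsphere_top {x. \<psi> x \<in> S}" by (simp add: continuous_map_def)
  then show "\<psi> -` S \<inter> space rsphere_borel \<in> sets rsphere_borel"
    by (intro sets_rsphere_borel_open) (simp add: vimage_def)
qed

definition rsphere_basis :: "rsphere set set" where
  "rsphere_basis = {Some ` V | V. open V \<and> bounded V}"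

lemma Int_stable_rsphere_basis: "Int_stable rsphere_basis"
proof (rule Int_stableI)
  fix a b assume "a \<in> rsphere_basis" "b \<in> rsphere_basis"
  then obtain V W where "a = Some ` V" "open V" "bounded V" "b = Some ` W" "open W"
    by (auto simp: rsphere_basis_def)
  then show "a \<inter> b \<in> rsphere_basis"
    unfolding rsphere_basis_def by (intro CollectI exI[of _ "V \<inter> W"]) (auto simp: bounded_Int)
qed

text \<open>An open set of the plane is a countable union of bounded open pieces, and a
  neighbourhood of infinity is the complement of a compact subset of the plane. Using bounded
  generators keeps infinity away from all of them, so that the continuous approximants of their
  indicators can vanish near infinity.\<close>

lemma sets_rsphere_borel_eq: "sets rsphere_borel = sigma_sets UNIV rsphere_basis"
proof -
  interpret B: sigma_algebra UNIV "sigma_sets UNIV rsphere_basis"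
    by (rule sigma_algebra_sigma_sets) auto
  have open_Some: "Some ` V \<in> sigma_sets UNIV rsphere_basis" if "open V" for V
  proof -
    have "Some ` (V \<inter> ball 0 (real n)) \<in> sigma_sets UNIV rsphere_basis" for n
      using that by (intro sigma_sets.Basic) (auto simp: rsphere_basis_def bounded_Int)
    then have "(\<Union>n. Some ` (V \<inter> ball 0 (real n))) \<in> sigma_sets UNIV rsphere_basis"
      by blast
    also have "(\<Union>n. Some ` (V \<inter> ball 0 (real n))) = Some ` V"
      using reals_Archimedean2 by (auto simp: image_iff)
    finally show ?thesis .
  qed
  have "U \<in> sigma_sets UNIV rsphere_basis" if "openin rsphere_top U" for U
  proof -
    from that consider (fin) V where "open V" "U = Some ` V"
      | (inf) C where "compact C" "U = insert None (Some ` (- C))"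
      unfolding rsphere_top_def openin_Alexandroff_compactification
      by (auto simp: Compl_eq_Diff_UNIV)
    then show ?thesis
    proof cases
      case inf
      have "UNIV - (Some ` UNIV - Some ` (- C)) \<in> sigma_sets UNIV rsphere_basis"
        using inf(1) by (intro B.Diff B.top open_Some) (auto intro: compact_imp_closed)
      moreover have "UNIV - (Some ` UNIV - Some ` (- C)) = U"
        using inf(2) by (auto simp: image_def)
      ultimately show ?thesis by simp
    qed (simp add: open_Some)
  qed
  moreover have "A \<in> sets rsphere_borel" if "A \<in> rsphere_basis" for A
    using that by (intro sets_rsphere_borel_open) (auto simp: rsphere_basis_def rsphere_top_def)
  ultimately show ?thesis
    unfolding rsphere_borel_def
    by (intro antisym) (auto intro!: sigma_sets_mono simp: sets_measure_of)
qed

lemma rsphere_basis_approx: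
  assumes "A \<in> rsphere_basis"
  obtains \<psi> :: "nat \<Rightarrow> rsphere \<Rightarrow> real"
  where "\<And>k. continuous_map rsphere_top euclideanreal (\<psi> k)" "\<And>k x. \<psi> k x \<in> {0..1}"
    "\<And>x. (\<lambda>k. \<psi> k x) \<longlonglongrightarrow> indicator A x"
proof -
  from assms obtain V where V: "open V" "bounded V" "A = Some ` V"
    by (auto simp: rsphere_basis_def)
  from V(2) obtain B where B: "B > 0" "\<And>z. z \<in> V \<Longrightarrow> norm z \<le> B" by (auto simp: bounded_pos)
  \<comment> \<open>\<open>infdist\<close> to the empty set is 0 by convention, which would make all
    the functions below vanish; boundedness of V rules this out.\<close>
  have ne: "- V \<noteq> {}" using V(2) not_bounded_UNIV[where 'a = complex] by (metis Compl_empty_eq double_compl)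
  define \<psi> :: "nat \<Rightarrow> rsphere \<Rightarrow> real"
    where "\<psi> k x = (case x of None \<Rightarrow> 0 | Some z \<Rightarrow> min 1 (real k * infdist z (- V)))" for k x
  show thesis
  proof (rule that)
    fix k
    show "continuous_map rsphere_top euclideanreal (\<psi> k)"
      unfolding continuous_map_rsphere_iff
    proof
      fix x
      show "isCont (\<lambda>w. \<psi> k (rsphere_param x w)) 0"
      proof (cases x)
        case (Some c)
        then show ?thesis
          by (simp add: \<psi>_def rsphere_param_def) (intro continuous_intros continuous_infdist)
      next
        \<comment> \<open>The chart disc of radius 1 / B around infinity misses V, so the function
          is locally 0 there.\<close>
        case None
        have "\<forall>\<^sub>F w in nhds 0. \<psi> k (rsphere_param x w) = 0"
          unfolding eventually_nhds_metric
        proof (intro exI[of _ "1 / B"] conjI allI impI)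
          fix w :: complex assume w: "dist w 0 < 1 / B"
          show "\<psi> k (rsphere_param x w) = 0"
          proof (cases "w = 0")
            case False
            have "inverse w \<notin> V"
            proof
              assume "inverse w \<in> V"
              from B(2)[OF this] show False
                using w False B(1) by (simp add: norm_inverse norm_divide field_simps)
            qed
            then show ?thesis using False None by (simp add: \<psi>_def rsphere_param_def)
          qed (simp add: \<psi>_def None)
        qed (use B in auto)
        then show ?thesis
          by (subst isCont_cong[where g = "\<lambda>_. 0"]) auto
      qed
    qed
  next
    fix k x
    show "\<psi> k x \<in> {0..1}" by (auto simp: \<psi>_def infdist_nonneg split: option.splits)
  next
    fix x
    show "(\<lambda>k. \<psi> k x) \<longlonglongrightarrow> indicator A x"
    proof (cases "x \<in> A")
      case False
      then have "\<psi> k x = 0" for k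
        using V by (auto simp: \<psi>_def inj_image_mem_iff infdist_zero split: option.splits)
      with False show ?thesis by simp
    next
      case True
      then obtain z where z: "z \<in> V" "x = Some z" using V by auto
      have "infdist z (- V) \<noteq> 0"
        using z in_closed_iff_infdist_zero[of "- V" z] ne V(1) by auto
      then have pos: "infdist z (- V) > 0" using infdist_nonneg[of z "- V"] by linarith
      obtain K :: nat where K: "1 / infdist z (- V) < K" using reals_Archimedean2 by blast
      have "\<psi> k x = 1" if "k \<ge> K" for k
      proof -
        have "1 / infdist z (- V) < k" using K that by linarith
        then have "1 \<le> k * infdist z (- V)" using pos by (simp add: field_simps)
        then show ?thesis by (simp add: \<psi>_def z(2))
      qed
      then have "\<forall>\<^sub>F k in sequentially. \<psi> k x = 1" by (auto simp: eventually_sequentially)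
      then show ?thesis using True by (simp add: tendsto_eventually)
    qed
  qed
qed

text \<open>The L1 closure of the continuous functions, called \<open>approx\<close> in the proof,
  is stable under sums, multiples and dominated pointwise limits. A Dynkin argument from
  \<open>rsphere_basis\<close> puts all indicators of Borel sets into it, and induction on
  integrable functions the rest.\<close>

lemma continuous_dense_L1_rsphere:
  fixes f :: "rsphere \<Rightarrow> real"
  assumes \<mu>: "finite_measure \<mu>" "sets \<mu> = sets rsphere_borel"
    and f: "integrable \<mu> f" and e: "e > 0"
  shows "\<exists>\<psi>. continuous_map rsphere_top euclideanreal \<psi> \<and> (\<integral>x. \<bar>f x - \<psi> x\<bar> \<partial>\<mu>) < e"
proof -
  interpret finite_measure \<mu> by fact
  have [simp]: "space \<mu> = UNIV" using sets_eq_imp_space_eq[OF \<mu>(2)] by simp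
  have intc: "integrable \<mu> \<psi>" if c: "continuous_map rsphere_top euclideanreal \<psi>" for \<psi>
  proof -
    obtain B where "\<And>x. \<bar>\<psi> x\<bar> \<le> B" using continuous_map_rsphere_bounded[OF c] by blast
    moreover have "\<psi> \<in> borel_measurable \<mu>"
      using borel_measurable_rsphere_continuous[OF c] by (simp add: measurable_cong_sets[OF \<mu>(2)])
    ultimately show ?thesis by (intro integrable_const_bound[of _ B]) auto
  qed
  define approx where "approx f \<longleftrightarrow> integrable \<mu> f \<and>
      (\<forall>e>0. \<exists>\<psi>. continuous_map rsphere_top euclideanreal \<psi> \<and> (\<integral>x. \<bar>f x - \<psi> x\<bar> \<partial>\<mu>) < e)" for f
  have approxD: "\<exists>\<psi>. continuous_map rsphere_top euclideanreal \<psi> \<and> (\<integral>x. \<bar>f x - \<psi> x\<bar> \<partial>\<mu>) < e"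
    if "approx f" "e > 0" for f e
    using that by (simp add: approx_def)
  have approx_cont: "approx \<psi>" if "continuous_map rsphere_top euclideanreal \<psi>" for \<psi>
    unfolding approx_def
  proof (intro conjI allI impI exI[of _ \<psi>])
    show "integrable \<mu> \<psi>" by (rule intc[OF that])
  qed (use that in simp_all)
  have approx_trans: "(\<integral>x. \<bar>f x - h x\<bar> \<partial>\<mu>) \<le> (\<integral>x. \<bar>f x - g x\<bar> \<partial>\<mu>) + (\<integral>x. \<bar>g x - h x\<bar> \<partial>\<mu>)"
    if "integrable \<mu> f" "integrable \<mu> g" "integrable \<mu> h" for f g h :: "rsphere \<Rightarrow> real"
  proof -
    have "(\<integral>x. \<bar>f x - h x\<bar> \<partial>\<mu>) \<le> (\<integral>x. \<bar>f x - g x\<bar> + \<bar>g x - h x\<bar> \<partial>\<mu>)"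
      using that by (intro integral_mono) auto
    also have "\<dots> = (\<integral>x. \<bar>f x - g x\<bar> \<partial>\<mu>) + (\<integral>x. \<bar>g x - h x\<bar> \<partial>\<mu>)"
      using that by (intro Bochner_Integration.integral_add) auto
    finally show ?thesis .
  qed
  have approx_lim: "approx g" if g: "integrable \<mu> g"
      and s: "\<And>i. approx (s i)" and lim: "(\<lambda>i. \<integral>x. \<bar>g x - s i x\<bar> \<partial>\<mu>) \<longlonglongrightarrow> 0"
    for g and s :: "nat \<Rightarrow> rsphere \<Rightarrow> real"
    unfolding approx_def
  proof (intro conjI allI impI g)
    fix e :: real assume e: "e > 0"
    have "\<forall>\<^sub>F i in sequentially. (\<integral>x. \<bar>g x - s i x\<bar> \<partial>\<mu>) < e / 2"
      using e lim by (intro order_tendstoD) auto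
    then obtain i where i: "(\<integral>x. \<bar>g x - s i x\<bar> \<partial>\<mu>) < e / 2"
      using eventually_happens by force
    obtain \<psi> where \<psi>: "continuous_map rsphere_top euclideanreal \<psi>" "(\<integral>x. \<bar>s i x - \<psi> x\<bar> \<partial>\<mu>) < e / 2"
      using approxD[OF s half_gt_zero[OF e], of i] by blast
    have "(\<integral>x. \<bar>g x - \<psi> x\<bar> \<partial>\<mu>) < e"
      using approx_trans[OF g _ intc[OF \<psi>(1)], of "s i"] s[of i] i \<psi>(2) by (simp add: approx_def)
    with \<psi>(1) show "\<exists>\<psi>. continuous_map rsphere_top euclideanreal \<psi> \<and> (\<integral>x. \<bar>g x - \<psi> x\<bar> \<partial>\<mu>) < e"
      by blast
  qed
  have approx_lim_dominated: "approx g" if g: "integrable \<mu> g" and s: "\<And>i. approx (s i)"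
      and lim: "\<And>x. (\<lambda>i. s i x) \<longlonglongrightarrow> g x" and bd: "\<And>i x. \<bar>s i x\<bar> \<le> w x" and w: "integrable \<mu> w"
    for g w and s :: "nat \<Rightarrow> rsphere \<Rightarrow> real"
  proof (rule approx_lim[OF g s])
    have int: "integrable \<mu> (s i)" for i using s[of i] by (simp add: approx_def)
    have "(\<lambda>i. \<integral>x. \<bar>g x - s i x\<bar> \<partial>\<mu>) \<longlonglongrightarrow> (\<integral>x. 0 \<partial>\<mu>)"
    proof (rule integral_dominated_convergence[where w = "\<lambda>x. \<bar>g x\<bar> + w x"])
      show "AE x in \<mu>. (\<lambda>i. \<bar>g x - s i x\<bar>) \<longlonglongrightarrow> 0"
      proof (rule AE_I2)
        fix x
        have "(\<lambda>i. \<bar>g x - s i x\<bar>) \<longlonglongrightarrow> \<bar>g x - g x\<bar>" by (intro tendsto_intros lim)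
        then show "(\<lambda>i. \<bar>g x - s i x\<bar>) \<longlonglongrightarrow> 0" by simp
      qed
      show "AE x in \<mu>. norm \<bar>g x - s i x\<bar> \<le> \<bar>g x\<bar> + w x" for i
      proof (rule AE_I2)
        fix x show "norm \<bar>g x - s i x\<bar> \<le> \<bar>g x\<bar> + w x" using bd[of i x] unfolding real_norm_def by linarith
      qed
    qed (use g w int in auto)
    then show "(\<lambda>i. \<integral>x. \<bar>g x - s i x\<bar> \<partial>\<mu>) \<longlonglongrightarrow> 0" by simp
  qed
  have approx_add: "approx (\<lambda>x. g x + h x)" if g: "approx g" and h: "approx h" for g h
    unfolding approx_def
  proof (intro conjI allI impI)
    show "integrable \<mu> (\<lambda>x. g x + h x)" using g h by (auto simp: approx_def)
    fix e :: real assume e: "e > 0"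
    obtain \<psi> where \<psi>: "continuous_map rsphere_top euclideanreal \<psi>" "(\<integral>x. \<bar>g x - \<psi> x\<bar> \<partial>\<mu>) < e / 2"
      using approxD[OF g half_gt_zero[OF e]] by blast
    obtain \<eta> where \<eta>: "continuous_map rsphere_top euclideanreal \<eta>" "(\<integral>x. \<bar>h x - \<eta> x\<bar> \<partial>\<mu>) < e / 2"
      using approxD[OF h half_gt_zero[OF e]] by blast
    note int = g[unfolded approx_def, THEN conjunct1] h[unfolded approx_def, THEN conjunct1]
      intc[OF \<psi>(1)] intc[OF \<eta>(1)]
    have "(\<integral>x. \<bar>g x + h x - (\<psi> x + \<eta> x)\<bar> \<partial>\<mu>) \<le> (\<integral>x. \<bar>g x - \<psi> x\<bar> + \<bar>h x - \<eta> x\<bar> \<partial>\<mu>)"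
      using int by (intro integral_mono) auto
    also have "\<dots> = (\<integral>x. \<bar>g x - \<psi> x\<bar> \<partial>\<mu>) + (\<integral>x. \<bar>h x - \<eta> x\<bar> \<partial>\<mu>)"
      using int by (intro Bochner_Integration.integral_add) auto
    also have "\<dots> < e" using \<psi>(2) \<eta>(2) by simp
    finally show "\<exists>\<psi>. continuous_map rsphere_top euclideanreal \<psi> \<and> (\<integral>x. \<bar>g x + h x - \<psi> x\<bar> \<partial>\<mu>) < e"
      using \<psi>(1) \<eta>(1) by (intro exI[of _ "\<lambda>x. \<psi> x + \<eta> x"]) (auto intro!: continuous_intros)
  qed
  have approx_scale: "approx (\<lambda>x. c * g x)" if g: "approx g" for g c
    unfolding approx_def
  proof (intro conjI allI impI)
    show "integrable \<mu> (\<lambda>x. c * g x)" using g by (auto simp: approx_def)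
    fix e :: real assume e: "e > 0"
    have c: "\<bar>c\<bar> + 1 > 0" by simp
    obtain \<psi> where \<psi>: "continuous_map rsphere_top euclideanreal \<psi>" "(\<integral>x. \<bar>g x - \<psi> x\<bar> \<partial>\<mu>) < e / (\<bar>c\<bar> + 1)"
      using approxD[OF g divide_pos_pos[OF e c]] by blast
    have "(\<integral>x. \<bar>c * g x - c * \<psi> x\<bar> \<partial>\<mu>) = \<bar>c\<bar> * (\<integral>x. \<bar>g x - \<psi> x\<bar> \<partial>\<mu>)"
      by (simp add: right_diff_distrib[symmetric] abs_mult)
    also have "\<dots> \<le> (\<bar>c\<bar> + 1) * (\<integral>x. \<bar>g x - \<psi> x\<bar> \<partial>\<mu>)"
      by (intro mult_right_mono integral_nonneg_AE) auto
    also have "\<dots> < e" using \<psi>(2) c by (simp add: field_simps)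
    finally show "\<exists>\<psi>. continuous_map rsphere_top euclideanreal \<psi> \<and> (\<integral>x. \<bar>c * g x - \<psi> x\<bar> \<partial>\<mu>) < e"
      using \<psi>(1) by (intro exI[of _ "\<lambda>x. c * \<psi> x"]) (auto intro!: continuous_intros)
  qed
  have approx_ind: "approx (indicator A)" if "A \<in> sets \<mu>" for A
  proof -
    have *: "rsphere_basis \<subseteq> Pow UNIV" by simp
    have "A \<in> sigma_sets UNIV rsphere_basis" using that \<mu>(2) sets_rsphere_borel_eq by simp
    with Int_stable_rsphere_basis * show ?thesis
    proof (induction rule: sigma_sets_induct_disjoint)
      case (basic A)
      then obtain \<psi> :: "nat \<Rightarrow> rsphere \<Rightarrow> real" where \<psi>:
        "\<And>k. continuous_map rsphere_top euclideanreal (\<psi> k)" "\<And>k x. \<psi> k x \<in> {0..1}"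
        "\<And>x. (\<lambda>k. \<psi> k x) \<longlonglongrightarrow> indicator A x"
        by (rule rsphere_basis_approx) (rule that)
      have "A \<in> sets \<mu>" using basic \<mu>(2) sets_rsphere_borel_eq by auto
      show ?case
      proof (rule approx_lim_dominated[where s = \<psi> and w = "\<lambda>_. 1"])
        show "integrable \<mu> (indicator A :: rsphere \<Rightarrow> real)"
          using \<open>A \<in> sets \<mu>\<close> by (simp add: less_top[symmetric])
        show "approx (\<psi> i)" for i by (rule approx_cont) (rule \<psi>(1))
        show "(\<lambda>i. \<psi> i x) \<longlonglongrightarrow> indicator A x" for x by (rule \<psi>(3))
        show "\<bar>\<psi> i x\<bar> \<le> 1" for i x using \<psi>(2)[of i x] by simp
      qed simp
    next
      case empty
      show ?case using approx_cont[of "\<lambda>_. 0"] by (simp add: indicator_def)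
    next
      case (compl A)
      have "approx (\<lambda>x. 1 + (-1) * indicator A x)"
        by (intro approx_add approx_scale compl approx_cont) auto
      also have "(\<lambda>x. 1 + (-1) * indicator A x) = (indicator (UNIV - A) :: rsphere \<Rightarrow> real)"
        by (auto simp: indicator_def)
      finally show ?case .
    next
      case (union A)
      have meas: "(\<Union>i. A i) \<in> sets \<mu>" using union(2) unfolding \<mu>(2) sets_rsphere_borel_eq
        by (intro sigma_sets.Union) auto
      have fin: "approx (\<lambda>x. \<Sum>i<n. indicator (A i) x)" for n
      proof (induction n)
        case 0
        show ?case by (simp add: approx_cont)
      next
        case (Suc n)
        show ?case using approx_add[OF Suc union(3)] by simp
      qed
      show ?case
      proof (rule approx_lim_dominated[where s = "\<lambda>n x. \<Sum>i<n. indicator (A i) x" and w = "\<lambda>_. 1"])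
        show "(\<lambda>n. \<Sum>i<n. indicator (A i) x) \<longlonglongrightarrow> (indicator (\<Union>i. A i) x :: real)" for x
          using indicator_sums[of A x] union(1) by (auto simp: sums_def disjoint_family_on_def)
        show "\<bar>\<Sum>i<n. indicator (A i) x\<bar> \<le> (1::real)" for n x
        proof -
          \<comment> \<open>Disjointness turns the partial sum into the indicator of a union, so the
            constant 1 dominates the whole sequence.\<close>
          have "(\<Sum>i<n. indicator (A i) x) = (indicator (\<Union>(A ` {..<n})) x :: real)"
            using union(1) by (intro indicator_UN_disjoint[symmetric]) (auto simp: disjoint_family_on_def)
          then show ?thesis by (simp only:) (simp add: indicator_def)
        qed
      qed (use meas fin in \<open>auto simp: less_top[symmetric]\<close>)
    qed
  qed
  have "approx f"
    using f
  proof (induction rule: integrable_induct)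
    case (base A c)
    then show ?case using approx_scale[OF approx_ind, of A c] by (simp add: mult.commute)
  next
    case (add f g)
    then show ?case by (intro approx_add)
  next
    case (lim f s)
    show ?case
      \<comment> \<open>The dominating function \<open>2 * \<bar>f x\<bar>\<close> is the bound that
        the induction rule supplies for its approximating sequence.\<close>
      by (rule approx_lim_dominated[where s = s and w = "\<lambda>x. 2 * \<bar>f x\<bar>"]) (use lim in auto)
  qed
  with e show ?thesis by (auto simp: approx_def)
qed

section \<open>Local degrees and preimages under rational maps\<close>

text \<open>\<open>has_local_degree g a n\<close>: in the coordinates centred at \<open>a\<close> and \<open>g a\<close>, the map \<open>g\<close> is
  \<open>w \<mapsto> w\<^sup>n * h w\<close> with a non-vanishing holomorphic \<open>h\<close>. In contrast to \<^const>\<open>local_degree\<close> this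
  also excludes that \<open>g\<close> takes the dummy values of the coordinate.\<close>

definition has_local_degree :: "(rsphere \<Rightarrow> rsphere) \<Rightarrow> rsphere \<Rightarrow> nat \<Rightarrow> bool" where
  "has_local_degree g a n \<longleftrightarrow> (\<exists>h. h analytic_on {0} \<and> h 0 \<noteq> 0 \<and>
     (\<forall>\<^sub>F w in nhds 0. g (rsphere_param a w) = rsphere_param (g a) (w ^ n * h w)))"

lemma has_local_degree_imp_local_degree:
  assumes "has_local_degree g a n"
  shows "local_degree g a = n"
proof -
  from assms obtain h where h: "h analytic_on {0}" "h 0 \<noteq> 0"
    and ev: "\<forall>\<^sub>F w in nhds 0. g (rsphere_param a w) = rsphere_param (g a) (w ^ n * h w)"
    by (auto simp: has_local_degree_def)
  obtain S where S: "open S" "0 \<in> S" "h holomorphic_on S" using h(1) by (auto simp: analytic_at)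
  obtain S' where S': "open S'" "0 \<in> S'"
    "\<And>w. w \<in> S' \<Longrightarrow> g (rsphere_param a w) = rsphere_param (g a) (w ^ n * h w)"
    using ev by (auto simp: eventually_nhds)
  have "zorder (\<lambda>w. rsphere_coord (g a) (g (rsphere_param a w))) 0 = int n"
  proof (rule zorder_eqI)
    show "open (S \<inter> S')" "0 \<in> S \<inter> S'" using S S' by auto
    show "h holomorphic_on (S \<inter> S')" using S(3) by (rule holomorphic_on_subset) auto
  qed (use h S' in \<open>auto simp: power_int_of_nat mult.commute\<close>)
  then show ?thesis by (simp add: local_degree_def)
qed

lemma has_local_degree_ident: "has_local_degree (\<lambda>x. x) a 1"
  unfolding has_local_degree_def by (intro exI[of _ "\<lambda>_. 1"]) auto

lemma preimage_sum_ident: "preimage_sum (\<lambda>x. x) \<psi> x = \<psi> x"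
  for \<psi> :: "rsphere \<Rightarrow> 'b::real_vector"
proof -
  have "(\<lambda>x. x) -` {x} = {x}" by auto
  then show ?thesis
    using has_local_degree_imp_local_degree[OF has_local_degree_ident] by (simp add: preimage_sum_def)
qed

text \<open>Substituting one normal form into the other gives the power n * m with the unit h^m
  times l composed with \<eta>. Positivity of n makes \<eta> vanish at 0, so that the inner map hits
  the centre of the next chart.\<close>

lemma has_local_degree_compose:
  assumes g: "has_local_degree g a n" and k: "has_local_degree k (g a) m" and n: "n > 0"
  shows "has_local_degree (k \<circ> g) a (n * m)"
proof -
  from g obtain h where h: "h analytic_on {0}" "h 0 \<noteq> 0"
    and evh: "\<forall>\<^sub>F w in nhds 0. g (rsphere_param a w) = rsphere_param (g a) (w ^ n * h w)"
    by (auto simp: has_local_degree_def)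
  from k obtain l where l: "l analytic_on {0}" "l 0 \<noteq> 0"
    and evl: "\<forall>\<^sub>F w in nhds 0. k (rsphere_param (g a) w) = rsphere_param (k (g a)) (w ^ m * l w)"
    by (auto simp: has_local_degree_def)
  define \<eta> where "\<eta> w = w ^ n * h w" for w
  have \<eta>0: "\<eta> 0 = 0" using n by (simp add: \<eta>_def)
  have \<eta>: "\<eta> analytic_on {0}" unfolding \<eta>_def by (intro analytic_intros h(1))
  then have "isCont \<eta> 0" by (rule analytic_at_imp_isCont)
  then have "filterlim \<eta> (nhds 0) (nhds 0)"
    using tendsto_at_iff_tendsto_nhds[of \<eta> 0] by (simp add: isCont_def \<eta>0)
  from eventually_compose_filterlim[OF evl this] evh
  have ev: "\<forall>\<^sub>F w in nhds 0. (k \<circ> g) (rsphere_param a w) =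
      rsphere_param ((k \<circ> g) a) (w ^ (n * m) * (h w ^ m * l (\<eta> w)))"
    by eventually_elim (simp add: \<eta>_def power_mult power_mult_distrib mult.assoc)
  have "(l \<circ> \<eta>) analytic_on {0}"
    by (rule analytic_on_compose[OF \<eta>]) (simp add: \<eta>0 l(1))
  then have "(\<lambda>w. h w ^ m * l (\<eta> w)) analytic_on {0}"
    unfolding comp_def by (intro analytic_intros h(1))
  with ev show ?thesis unfolding has_local_degree_def
    by (intro exI[of _ "\<lambda>w. h w ^ m * l (\<eta> w)"]) (simp add: h(2) l(2) \<eta>0)
qed

text \<open>The preimages under the composition are grouped by their intermediate image
  \<open>g y\<close>; multiplicativity of the local degree then factors each weight.\<close>

lemma preimage_sum_compose:
  fixes \<psi> :: "rsphere \<Rightarrow> 'b::real_vector"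
  assumes g: "\<And>a. has_local_degree g a (local_degree g a)" "\<And>a. local_degree g a > 0"
    and k: "\<And>a. has_local_degree k a (local_degree k a)"
    and fin: "\<And>x. finite (g -` {x})" "\<And>x. finite (k -` {x})"
  shows "preimage_sum (k \<circ> g) \<psi> x = preimage_sum k (preimage_sum g \<psi>) x"
proof -
  have deg: "local_degree (k \<circ> g) a = local_degree g a * local_degree k (g a)" for a
    by (intro has_local_degree_imp_local_degree has_local_degree_compose g k)
  have eq: "(k \<circ> g) -` {x} = (\<Union>z\<in>k -` {x}. g -` {z})" by auto
  then have "finite ((k \<circ> g) -` {x})" using fin by simp
  then have "preimage_sum (k \<circ> g) \<psi> x =
      (\<Sum>z\<in>k -` {x}. \<Sum>y\<in>{y. y \<in> (k \<circ> g) -` {x} \<and> g y = z}. real (local_degree (k \<circ> g) y) *\<^sub>R \<psi> y)"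
    unfolding preimage_sum_def by (intro sum.group[symmetric] fin) auto
  also have "\<dots> = (\<Sum>z\<in>k -` {x}. \<Sum>y\<in>g -` {z}. real (local_degree k z) *\<^sub>R (real (local_degree g y) *\<^sub>R \<psi> y))"
    by (intro sum.cong) (auto simp: deg mult.commute)
  also have "\<dots> = preimage_sum k (preimage_sum g \<psi>) x"
    unfolding preimage_sum_def by (simp add: scaleR_sum_right)
  finally show ?thesis .
qed

section \<open>Zeros of complex polynomials, counted with multiplicity, under perturbation\<close>

lemma zorder_poly_eq_order:
  fixes P :: "complex poly"
  assumes "P \<noteq> 0"
  shows "zorder (poly P) z = int (order z P)"
proof -
  obtain R where R: "P = [:-z, 1:] ^ order z P * R" "\<not> [:-z, 1:] dvd R"
    using order_decomp[OF assms] by blast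
  show ?thesis
  proof (rule zorder_eqI[of UNIV _ "poly R"])
    show "poly R z \<noteq> 0" using R(2) by (simp add: poly_eq_0_iff_dvd)
    fix w
    show "poly P w = poly R w * (w - z) powi int (order z P)"
      by (subst R(1)) (simp add: power_int_of_nat mult.commute)
  qed (auto intro: holomorphic_intros)
qed

lemma sum_order_roots:
  fixes P :: "complex poly"
  assumes "P \<noteq> 0"
  shows "(\<Sum>z\<in>{z. poly P z = 0}. order z P) = degree P"
  using size_proots_complex[of P] assms by (simp add: size_multiset_overloaded_eq)

lemma eventually_norm_poly_less:
  fixes A B :: "complex poly"
  assumes K: "compact K" and A: "\<And>z. z \<in> K \<Longrightarrow> poly A z \<noteq> 0"
  shows "\<forall>\<^sub>F u in nhds 0. \<forall>z\<in>K. norm (u * poly B z) < norm (poly A z)"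
proof (cases "K = {}")
  case False
  obtain m where m: "m > 0" "\<And>z. z \<in> K \<Longrightarrow> m \<le> norm (poly A z)"
  proof -
    have "continuous_on K (\<lambda>z. norm (poly A z))" by (intro continuous_intros)
    from continuous_attains_inf[OF K False this] obtain z where
      z: "z \<in> K" "\<And>y. y \<in> K \<Longrightarrow> norm (poly A z) \<le> norm (poly A y)" by auto
    with A[OF z(1)] show thesis by (intro that[of "norm (poly A z)"]) auto
  qed
  obtain N where N: "\<And>z. z \<in> K \<Longrightarrow> norm (poly B z) \<le> N"
  proof -
    have "continuous_on K (\<lambda>z. norm (poly B z))" by (intro continuous_intros)
    from continuous_attains_sup[OF K False this] show thesis using that by blast
  qed
  have "N \<ge> 0" using N False norm_ge_zero order_trans by blast
  have "norm (u * poly B z) < norm (poly A z)" if u: "dist u 0 < m / (N + 1)" and z: "z \<in> K" for u z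
  proof -
    have "norm (u * poly B z) \<le> norm u * (N + 1)"
      using N[OF z] by (auto simp: norm_mult intro!: mult_left_mono)
    also have "\<dots> < m" using u \<open>N \<ge> 0\<close> by (simp add: field_simps)
    finally show ?thesis using m(2)[OF z] by linarith
  qed
  then show ?thesis unfolding eventually_nhds_metric using m(1) \<open>N \<ge> 0\<close>
    by (intro exI[of _ "m / (N + 1)"]) auto
qed simp

text \<open>Rouche's theorem on the circle around a: it carries no zero of A, so by compactness
  \<open>u * poly B z\<close> is smaller than \<open>poly A z\<close> there for all small u. Inside,
  A has the single zero a.\<close>

lemma sum_order_nearby_roots:
  fixes A B :: "complex poly"
  assumes A: "A \<noteq> 0" and r: "r > 0"
    and only: "\<And>z. z \<in> cball a r \<Longrightarrow> poly A z = 0 \<longleftrightarrow> z = a"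
  shows "\<forall>\<^sub>F u in nhds 0.
    (\<Sum>z\<in>{z \<in> ball a r. poly (A - smult u B) z = 0}. order z (A - smult u B)) = order a A"
proof -
  have ne: "sphere a r \<noteq> {}" using r by auto
  have "\<forall>\<^sub>F u in nhds 0. \<forall>z\<in>sphere a r. norm (u * poly B z) < norm (poly A z)"
    using only r by (intro eventually_norm_poly_less) auto
  then show ?thesis
  proof eventually_elim
    case (elim u)
    define P where "P = A - smult u B"
    have less: "norm (- (u * poly B z)) < norm (poly A z)" if "z \<in> sphere a r" for z
      using elim that by simp
    have P_sphere: "poly P z \<noteq> 0" if "z \<in> sphere a r" for z
      using less[OF that] by (auto simp: P_def)
    have P: "P \<noteq> 0"
    proof
      assume "P = 0"
      with P_sphere ne show False by (metis ex_in_conv poly_0)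
    qed
    have A_sphere: "poly A z \<noteq> 0" if "z \<in> sphere a r" for z
      using only[of z] that r by auto
    have eq: "(\<lambda>z. poly A z + - (u * poly B z)) = poly P" by (auto simp: P_def)
    have w1: "winding_number (circlepath a r) z = 1" if "z \<in> ball a r" for z
      using that by (intro winding_number_circlepath) (auto simp: dist_norm norm_minus_commute)
    have w0: "winding_number (circlepath a r) z = 0" if "z \<notin> cball a r" for z
      using that r by (intro winding_number_zero_outside[of _ "cball a r"]) (auto simp: sphere_def)
    \<comment> \<open>Rouche's theorem counts all zeros with their winding numbers. Those in the
      ball have winding number 1, those beyond the circle 0, which leaves the sum of orders over the
      ball.\<close>
    have count: "(\<Sum>z\<in>{z\<in>UNIV. poly Q z = 0}. winding_number (circlepath a r) z * zorder (poly Q) z) =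
        of_nat (\<Sum>z\<in>{z \<in> ball a r. poly Q z = 0}. order z Q)"
      if Q: "Q \<noteq> 0" "\<And>z. z \<in> sphere a r \<Longrightarrow> poly Q z \<noteq> 0" for Q
    proof -
      have "(\<Sum>z\<in>{z\<in>UNIV. poly Q z = 0}. winding_number (circlepath a r) z * zorder (poly Q) z) =
          (\<Sum>z\<in>{z \<in> ball a r. poly Q z = 0}. winding_number (circlepath a r) z * zorder (poly Q) z)"
      proof (rule sum.mono_neutral_right)
        show "finite {z\<in>UNIV. poly Q z = 0}" using poly_roots_finite[OF Q(1)] by simp
        show "\<forall>z\<in>{z\<in>UNIV. poly Q z = 0} - {z \<in> ball a r. poly Q z = 0}.
            winding_number (circlepath a r) z * zorder (poly Q) z = 0"
        proof
          fix z assume z: "z \<in> {z\<in>UNIV. poly Q z = 0} - {z \<in> ball a r. poly Q z = 0}"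
          then have "z \<notin> sphere a r" using Q(2) by auto
          with z have "z \<notin> cball a r" by auto
          then show "winding_number (circlepath a r) z * zorder (poly Q) z = 0" using w0 by simp
        qed
      qed auto
      also have "\<dots> = (\<Sum>z\<in>{z \<in> ball a r. poly Q z = 0}. of_nat (order z Q))"
        by (intro sum.cong) (auto simp: w1 zorder_poly_eq_order[OF Q(1)])
      finally show ?thesis by simp
    qed
    have "(\<Sum>z\<in>{z\<in>UNIV. poly A z + - (u * poly B z) = 0}.
          winding_number (circlepath a r) z * zorder (\<lambda>z. poly A z + - (u * poly B z)) z) =
        (\<Sum>z\<in>{z\<in>UNIV. poly A z = 0}. winding_number (circlepath a r) z * zorder (poly A) z)"
    proof (rule Rouche_theorem)
      show "finite {z\<in>UNIV. poly A z = 0}" using poly_roots_finite[OF A] by simp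
      show "finite {z\<in>UNIV. poly A z + - (u * poly B z) = 0}"
        using poly_roots_finite[OF P] by (simp add: P_def)
      show "\<forall>z\<in>path_image (circlepath a r). norm (- (u * poly B z)) < norm (poly A z)"
        using less r by simp
    qed (auto intro!: holomorphic_intros)
    then have "(\<Sum>z\<in>{z\<in>UNIV. poly P z = 0}. winding_number (circlepath a r) z * zorder (poly P) z) =
        (\<Sum>z\<in>{z\<in>UNIV. poly A z = 0}. winding_number (circlepath a r) z * zorder (poly A) z)"
      unfolding eq by (simp add: P_def)
    then have "(\<Sum>z\<in>{z \<in> ball a r. poly P z = 0}. order z P) = (\<Sum>z\<in>{z \<in> ball a r. poly A z = 0}. order z A)"
      by (subst (asm) (1 2) count) (use P P_sphere A A_sphere in \<open>auto simp only: of_nat_eq_iff\<close>)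
    also have "{z \<in> ball a r. poly A z = 0} = {a}" using only r by auto
    finally show ?case unfolding P_def by simp
  qed
qed

text \<open>The point of the projective line with homogeneous coordinates [a : b], meaningful when a
  and b are not both 0.\<close>

definition proj_point :: "complex \<Rightarrow> complex \<Rightarrow> rsphere" where
  "proj_point a b = (if b = 0 then None else Some (a / b))"

lemma proj_point_eq_param_iff:
  assumes "a \<noteq> 0 \<or> b \<noteq> 0"
  shows "proj_point a b = rsphere_param x u \<longleftrightarrow>
    (case x of Some v \<Rightarrow> a - v * b | None \<Rightarrow> b) = u * (case x of Some v \<Rightarrow> b | None \<Rightarrow> a)"
  using assms by (cases x) (auto simp: proj_point_def rsphere_param_def field_simps)

section \<open>Fibres and local degrees of a rational map through polynomials\<close>

locale ratmap =
  fixes p q :: "complex poly" and d :: nat and f :: "rsphere \<Rightarrow> rsphere"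
  assumes q_nonzero: "q \<noteq> 0" and coprime: "coprime p q"
    and d_eq: "d = max (degree p) (degree q)" and d_ge_2: "d \<ge> 2"
    and f_eq: "f = ratfun p q"
begin

text \<open>\<open>num x / den x\<close> is \<open>f\<close> composed with the coordinate centred at \<open>x\<close>.\<close>

definition num :: "rsphere \<Rightarrow> complex poly" where
  "num x = (case x of Some v \<Rightarrow> p - smult v q | None \<Rightarrow> q)"

definition den :: "rsphere \<Rightarrow> complex poly" where
  "den x = (case x of Some v \<Rightarrow> q | None \<Rightarrow> p)"

lemma no_common_root: "poly p z \<noteq> 0 \<or> poly q z \<noteq> 0"
proof (rule ccontr)
  assume "\<not> ?thesis"
  then have "[:-z, 1:] dvd p" "[:-z, 1:] dvd q" by (simp_all add: poly_eq_0_iff_dvd)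
  with coprime have "is_unit [:-z, 1:]" by (rule coprime_common_divisor)
  then show False by (simp add: is_unit_pCons_iff)
qed

lemma coeff_d_nonzero: "coeff p d \<noteq> 0 \<or> coeff q d \<noteq> 0"
  using d_eq d_ge_2 by (cases "degree p \<le> degree q") (auto simp: max_def leading_coeff_0_iff)

text \<open>Cross-multiplication in homogeneous coordinates yields one equation linear in u, whether
  x and the value of f are finite or infinite; coprimality excludes the coordinates [0 : 0].\<close>

lemma f_Some_iff: "f (Some z) = rsphere_param x u \<longleftrightarrow> poly (num x) z = u * poly (den x) z"
proof -
  have "f (Some z) = proj_point (poly p z) (poly q z)"
    by (simp add: f_eq ratfun_def proj_point_def)
  then show ?thesis using proj_point_eq_param_iff[OF no_common_root[of z], of x u]
    by (cases x) (simp_all add: num_def den_def)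
qed

lemma f_None_iff: "f None = rsphere_param x u \<longleftrightarrow> coeff (num x) d = u * coeff (den x) d"
proof -
  have "f None = proj_point (coeff p d) (coeff q d)"
    by (simp add: f_eq ratfun_def proj_point_def d_eq Let_def)
  then show ?thesis using proj_point_eq_param_iff[OF coeff_d_nonzero, of x u]
    by (cases x) (simp_all add: num_def den_def)
qed

lemma f_Some_eq_iff: "f (Some z) = x \<longleftrightarrow> poly (num x) z = 0"
  using f_Some_iff[of z x 0] by simp

lemma f_None_eq_iff: "f None = x \<longleftrightarrow> coeff (num x) d = 0"
  using f_None_iff[of x 0] by simp

lemma degree_num: "degree (num x) \<le> d"
  by (cases x) (auto simp: num_def d_eq intro!: degree_diff_le order_trans[OF degree_smult_le])

lemma degree_den: "degree (den x) \<le> d"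
  by (cases x) (auto simp: den_def d_eq)

lemma num_nonzero: "num x \<noteq> 0"
proof (cases x)
  case (Some v)
  show ?thesis
  proof
    assume "num x = 0"
    then have p: "p = smult v q" by (simp add: num_def Some)
    then have "q dvd p" by (simp add: dvd_smult)
    with coprime have "is_unit q" by (meson coprime_common_divisor dvd_refl)
    then have "degree q = 0" by (simp add: is_unit_iff_degree q_nonzero)
    moreover have "degree p = 0" using p \<open>degree q = 0\<close> degree_smult_le[of v q] by simp
    ultimately show False using d_eq d_ge_2 by simp
  qed
qed (simp add: num_def q_nonzero)

lemma den_root: "poly (num x) z = 0 \<Longrightarrow> poly (den x) z \<noteq> 0"
  using no_common_root[of z] by (cases x) (auto simp: num_def den_def)

lemma coeff_den_d: "coeff (num x) d = 0 \<Longrightarrow> coeff (den x) d \<noteq> 0"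
  using coeff_d_nonzero by (cases x) (auto simp: num_def den_def)

text \<open>Moving the target from x to its neighbour with coordinate u moves the defining
  polynomial linearly in u, up to a nonzero constant that changes neither zeros nor orders. This is
  what makes the perturbation lemma \<open>sum_order_nearby_roots\<close> applicable to fibres of f.
  The constant is -u when a finite target is seen from infinity, and 1 otherwise.\<close>

lemma num_param: "\<exists>c. c \<noteq> 0 \<and> num x - smult u (den x) = smult c (num (rsphere_param x u))"
proof (cases "x = None \<and> u \<noteq> 0")
  case True
  then show ?thesis
    by (intro exI[of _ "-u"]) (simp add: num_def den_def rsphere_param_def smult_diff_right)
next
  case False
  then show ?thesis
    by (intro exI[of _ 1]) (auto simp: num_def den_def rsphere_param_def smult_add_left split: option.splits)
qed

lemma vimage_f: "f -` {x} = Some ` {z. poly (num x) z = 0} \<union> (if degree (num x) < d then {None} else {})"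
proof -
  have "coeff (num x) d = 0 \<longleftrightarrow> degree (num x) < d"
    using degree_num[of x] num_nonzero[of x] by (metis coeff_eq_0 le_neq_implies_less leading_coeff_0_iff)
  then have "y \<in> f -` {x} \<longleftrightarrow> y \<in> Some ` {z. poly (num x) z = 0} \<union> (if degree (num x) < d then {None} else {})" for y
    using f_Some_eq_iff f_None_eq_iff[of x] by (cases y) auto
  then show ?thesis by blast
qed

lemma finite_vimage_f: "finite (f -` {x})"
  unfolding vimage_f using poly_roots_finite[OF num_nonzero] by auto

lemma poly_shift_analytic: "(\<lambda>w. poly R (c + w)) analytic_on {0}" for R :: "complex poly"
  by (intro holomorphic_on_imp_analytic_at[of _ UNIV] holomorphic_intros) auto

text \<open>The factor (X - z)^n is split off \<open>num x\<close>; the unit is the cofactor divided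
  by \<open>den x\<close>, which has no zero in common with \<open>num x\<close>.\<close>

lemma has_local_degree_Some:
  "has_local_degree f (Some z) (order z (num (f (Some z))))"
proof -
  define x where "x = f (Some z)"
  define n where "n = order z (num x)"
  obtain R where R: "num x = [:-z, 1:] ^ n * R" "\<not> [:-z, 1:] dvd R"
    using order_decomp[OF num_nonzero] unfolding n_def by blast
  have root: "poly (num x) z = 0" using f_Some_eq_iff[of z x] by (simp add: x_def)
  define h where "h w = poly R (z + w) / poly (den x) (z + w)" for w
  have h: "h analytic_on {0}"
    unfolding h_def by (intro analytic_on_divide poly_shift_analytic) (use den_root[OF root] in auto)
  have h0: "h 0 \<noteq> 0"
    using den_root[OF root] R(2) by (simp add: h_def poly_eq_0_iff_dvd)
  have "((\<lambda>w. poly (den x) (z + w)) \<longlongrightarrow> poly (den x) (z + 0)) (nhds 0)"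
    by (intro tendsto_intros filterlim_ident)
  from tendsto_imp_eventually_ne[OF this, of 0] den_root[OF root]
  have "\<forall>\<^sub>F w in nhds 0. poly (den x) (z + w) \<noteq> 0" by simp
  then have "\<forall>\<^sub>F w in nhds 0. f (rsphere_param (Some z) w) = rsphere_param (f (Some z)) (w ^ n * h w)"
  proof eventually_elim
    case (elim w)
    have "f (Some (z + w)) = rsphere_param x (w ^ n * h w)"
      unfolding f_Some_iff using elim by (subst R(1)) (simp add: h_def)
    then show ?case by (simp add: rsphere_param_def x_def)
  qed
  with h h0 show ?thesis unfolding has_local_degree_def n_def x_def by blast
qed

text \<open>In the chart 1 / w both polynomials are multiplied by w^d. This turns
  \<open>den x\<close>, of exact degree d here, into its reflection, and \<open>num x\<close> into
  its reflection times w to the missing degree. Reflections of nonzero polynomials do not vanish at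
  0.\<close>

lemma has_local_degree_None:
  "has_local_degree f None (d - degree (num (f None)))"
proof -
  define x where "x = f None"
  define n where "n = d - degree (num x)"
  have c0: "coeff (num x) d = 0" using f_None_eq_iff[of x] by (simp add: x_def)
  from coeff_den_d[OF this] have cd: "coeff (den x) d \<noteq> 0" .
  then have dd: "degree (den x) = d" using degree_den[of x] le_degree[OF cd] by simp
  define h where "h w = poly (reflect_poly (num x)) (0 + w) / poly (reflect_poly (den x)) (0 + w)" for w
  have den0: "poly (reflect_poly (den x)) (0 + 0) \<noteq> 0" using cd dd by simp
  have h: "h analytic_on {0}"
    unfolding h_def by (intro analytic_on_divide poly_shift_analytic) (use den0 in auto)
  have h0: "h 0 \<noteq> 0" using den0 num_nonzero[of x] by (simp add: h_def)
  have n: "n > 0"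
    using degree_num[of x] c0 num_nonzero[of x] unfolding n_def
    by (metis diff_is_0_eq' le_antisym leading_coeff_0_iff neq0_conv diff_is_0_eq)
  have "((\<lambda>w. poly (reflect_poly (den x)) (0 + w)) \<longlongrightarrow> poly (reflect_poly (den x)) (0 + 0)) (nhds 0)"
    by (intro tendsto_intros filterlim_ident)
  from tendsto_imp_eventually_ne[OF this den0]
  have "\<forall>\<^sub>F w in nhds 0. poly (reflect_poly (den x)) (0 + w) \<noteq> 0" .
  then have "\<forall>\<^sub>F w in nhds 0. f (rsphere_param None w) = rsphere_param (f None) (w ^ n * h w)"
  proof eventually_elim
    case (elim w)
    show ?case
    proof (cases "w = 0")
      case False
      have 1: "w ^ n * poly (reflect_poly (num x)) w = w ^ d * poly (num x) (inverse w)"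
        using False degree_num[of x] by (simp add: n_def poly_reflect_poly_nz power_add[symmetric] flip: mult.assoc)
      have 2: "poly (reflect_poly (den x)) w = w ^ d * poly (den x) (inverse w)"
        using False by (simp add: poly_reflect_poly_nz dd)
      have "w ^ d * poly (num x) (inverse w) = w ^ d * (w ^ n * h w * poly (den x) (inverse w))"
        using elim False 1 2 by (simp add: h_def field_simps)
      then have "poly (num x) (inverse w) = w ^ n * h w * poly (den x) (inverse w)"
        using False by simp
      then have "f (Some (inverse w)) = rsphere_param x (w ^ n * h w)"
        unfolding f_Some_iff .
      then show ?thesis using False by (simp add: rsphere_param_def[of None] x_def)
    qed (use n in \<open>simp add: zero_power\<close>)
  qed
  with h h0 show ?thesis unfolding has_local_degree_def n_def x_def by blast
qed

lemma local_degree_Some: "f (Some z) = x \<Longrightarrow> local_degree f (Some z) = order z (num x)"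
  using has_local_degree_imp_local_degree[OF has_local_degree_Some] by auto

lemma local_degree_None: "f None = x \<Longrightarrow> local_degree f None = d - degree (num x)"
  using has_local_degree_imp_local_degree[OF has_local_degree_None] by auto

lemma has_local_degree_f: "has_local_degree f y (local_degree f y)"
  using has_local_degree_Some has_local_degree_None local_degree_Some local_degree_None
  by (cases y) auto

lemma local_degree_pos: "local_degree f y > 0"
proof (cases y)
  case None
  have "degree (num (f None)) < d" using vimage_f[of "f None"] by (auto split: if_splits)
  then show ?thesis using local_degree_None None by simp
next
  case (Some z)
  then show ?thesis
    using f_Some_eq_iff[of z "f (Some z)"] num_nonzero[of "f (Some z)"]
    by (simp add: local_degree_Some[OF refl] order_gt_0_iff)
qed

lemma preimage_sum_f:
  fixes \<psi> :: "rsphere \<Rightarrow> 'b::real_vector"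
  shows "preimage_sum f \<psi> x = (\<Sum>z\<in>{z. poly (num x) z = 0}. real (order z (num x)) *\<^sub>R \<psi> (Some z))
     + real (d - degree (num x)) *\<^sub>R \<psi> None"
proof -
  have "preimage_sum f \<psi> x = (\<Sum>y\<in>Some ` {z. poly (num x) z = 0}. real (local_degree f y) *\<^sub>R \<psi> y)
      + (\<Sum>y\<in>(if degree (num x) < d then {None} else {}). real (local_degree f y) *\<^sub>R \<psi> y)"
    unfolding preimage_sum_def vimage_f
    by (intro sum.union_disjoint) (auto intro!: finite_imageI poly_roots_finite num_nonzero)
  also have "(\<Sum>y\<in>Some ` {z. poly (num x) z = 0}. real (local_degree f y) *\<^sub>R \<psi> y) =
      (\<Sum>z\<in>{z. poly (num x) z = 0}. real (order z (num x)) *\<^sub>R \<psi> (Some z))"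
    by (subst sum.reindex) (auto intro!: sum.cong simp: local_degree_Some f_Some_eq_iff)
  also have "(\<Sum>y\<in>(if degree (num x) < d then {None} else {}). real (local_degree f y) *\<^sub>R \<psi> y) =
      real (d - degree (num x)) *\<^sub>R \<psi> None"
  proof (cases "degree (num x) < d")
    case True
    then have "f None = x" using vimage_f[of x] by auto
    with True show ?thesis by (simp add: local_degree_None)
  qed simp
  finally show ?thesis .
qed

text \<open>The orders of the finite preimages add up to the degree of \<open>num x\<close> by the
  fundamental theorem of algebra, and infinity supplies the rest up to d.\<close>

lemma preimage_sum_const: "preimage_sum f (\<lambda>_. c) x = real d *\<^sub>R c" for c :: "'b::real_vector"
proof -
  have "preimage_sum f (\<lambda>_. c) x = real ((\<Sum>z\<in>{z. poly (num x) z = 0}. order z (num x)) + (d - degree (num x))) *\<^sub>R c"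
    by (simp add: preimage_sum_f scaleR_sum_left scaleR_left_distrib)
  then show ?thesis using degree_num[of x] by (simp add: sum_order_roots[OF num_nonzero])
qed

text \<open>For a target near x, each zero z0 of A = \<open>num x\<close> is replaced by as many
  zeros close to z0, while all other zeros are close to infinity. Since the total weight stays d,
  the two sums differ only by the small oscillation of \<psi> near these limit points.\<close>

lemma continuous_preimage_sum:
  fixes \<psi> :: "rsphere \<Rightarrow> real"
  assumes \<psi>: "continuous_map rsphere_top euclideanreal \<psi>"
  shows "continuous_map rsphere_top euclideanreal (preimage_sum f \<psi>)"
  unfolding continuous_map_rsphere_iff
proof
  fix x
  define A where "A = num x"
  define B where "B = den x"
  define Z where "Z = {z. poly A z = 0}"
  have A0: "A \<noteq> 0" and degA: "degree A \<le> d" by (simp_all add: A_def num_nonzero degree_num)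
  have finZ: "finite Z" unfolding Z_def by (rule poly_roots_finite[OF A0])
  have "((\<lambda>u. preimage_sum f \<psi> (rsphere_param x u)) \<longlongrightarrow> preimage_sum f \<psi> x) (nhds 0)"
  proof (rule tendstoI)
    fix e :: real assume e: "e > 0"
    \<comment> \<open>The finite preimages have total weight at most d; the extra 1 makes the final
      inequality strict.\<close>
    define \<epsilon> where "\<epsilon> = e / (d + 1)"
    have \<epsilon>: "\<epsilon> > 0" using e by (simp add: \<epsilon>_def)
    have cont: "\<exists>\<delta>>0. \<forall>w. norm w < \<delta> \<longrightarrow> \<bar>\<psi> (rsphere_param y w) - \<psi> y\<bar> < \<epsilon>" for y
      using \<psi>[unfolded continuous_map_rsphere_iff, rule_format, of y] \<epsilon>
      unfolding continuous_at_eps_delta by (auto simp: dist_norm)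
    have "\<forall>\<^sub>F r in at_right 0. \<forall>z0\<in>Z. (\<forall>z\<in>cball z0 (2 * r). poly A z = 0 \<longrightarrow> z = z0) \<and>
        (\<forall>z\<in>ball z0 r. \<bar>\<psi> (Some z) - \<psi> (Some z0)\<bar> < \<epsilon>)"
    proof (intro eventually_ball_finite finZ ballI)
      fix z0 assume "z0 \<in> Z"
      obtain \<delta> where \<delta>: "\<delta> > 0" "\<And>w. norm w < \<delta> \<Longrightarrow> \<bar>\<psi> (rsphere_param (Some z0) w) - \<psi> (Some z0)\<bar> < \<epsilon>"
        using cont by blast
      obtain \<eta> where \<eta>: "\<eta> > 0" "\<And>z. z \<in> Z \<Longrightarrow> z \<noteq> z0 \<Longrightarrow> \<eta> \<le> dist z0 z"
        using finite_set_avoid[OF finZ, of z0] by blast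
      show "\<forall>\<^sub>F r in at_right 0. (\<forall>z\<in>cball z0 (2 * r). poly A z = 0 \<longrightarrow> z = z0) \<and>
        (\<forall>z\<in>ball z0 r. \<bar>\<psi> (Some z) - \<psi> (Some z0)\<bar> < \<epsilon>)"
        unfolding eventually_at_right_field
      proof (intro exI[of _ "min \<delta> (\<eta> / 2)"] conjI allI impI ballI)
        fix r z :: "real" and z' :: complex
        assume r: "r > 0" "r < min \<delta> (\<eta> / 2)"
        {
          fix z assume z: "z \<in> cball z0 (2 * r)" "poly A z = 0"
          show "z = z0"
          proof (rule ccontr)
            assume "z \<noteq> z0"
            with \<eta>(2)[of z] z r show False by (auto simp: Z_def)
          qed
        }
        {
          fix z assume z: "z \<in> ball z0 r"
          then show "\<bar>\<psi> (Some z) - \<psi> (Some z0)\<bar> < \<epsilon>"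
            using \<delta>(2)[of "z - z0"] r by (simp add: rsphere_param_def dist_norm norm_minus_commute)
        }
      qed (use \<delta> \<eta> in auto)
    qed
    moreover have "\<forall>\<^sub>F r in at_right 0. \<forall>z. norm z > 1 / r \<longrightarrow> \<bar>\<psi> (Some z) - \<psi> None\<bar> < \<epsilon>"
    proof -
      obtain \<delta> where \<delta>: "\<delta> > 0" "\<And>w. norm w < \<delta> \<Longrightarrow> \<bar>\<psi> (rsphere_param None w) - \<psi> None\<bar> < \<epsilon>"
        using cont by blast
      have "\<bar>\<psi> (Some z) - \<psi> None\<bar> < \<epsilon>" if "r > 0" "r < \<delta>" "norm z > 1 / r" for r z
      proof -
        have "z \<noteq> 0" using that by auto
        then have "norm (inverse z) < r" using that by (simp add: norm_inverse norm_divide field_simps)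
        with that \<delta>(2)[of "inverse z"] \<open>z \<noteq> 0\<close> show ?thesis by (simp add: rsphere_param_def)
      qed
      then show ?thesis unfolding eventually_at_right_field using \<delta>(1) by blast
    qed
    moreover have "\<forall>\<^sub>F r in at_right 0. r > (0::real)" by (rule eventually_at_right_less)
    ultimately have "\<forall>\<^sub>F r in at_right 0. (\<forall>z0\<in>Z. (\<forall>z\<in>cball z0 (2 * r). poly A z = 0 \<longrightarrow> z = z0) \<and>
        (\<forall>z\<in>ball z0 r. \<bar>\<psi> (Some z) - \<psi> (Some z0)\<bar> < \<epsilon>)) \<and>
        (\<forall>z. norm z > 1 / r \<longrightarrow> \<bar>\<psi> (Some z) - \<psi> None\<bar> < \<epsilon>) \<and> r > 0"
      by eventually_elim simp
    then obtain r where r: "r > 0"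
      and iso: "\<And>z0 z. z0 \<in> Z \<Longrightarrow> z \<in> cball z0 (2 * r) \<Longrightarrow> poly A z = 0 \<Longrightarrow> z = z0"
      and near: "\<And>z0 z. z0 \<in> Z \<Longrightarrow> z \<in> ball z0 r \<Longrightarrow> \<bar>\<psi> (Some z) - \<psi> (Some z0)\<bar> < \<epsilon>"
      and far: "\<And>z. norm z > 1 / r \<Longrightarrow> \<bar>\<psi> (Some z) - \<psi> None\<bar> < \<epsilon>"
      using eventually_happens'[OF trivial_limit_at_right_real] by blast
    \<comment> \<open>The isolation radius was taken as 2 * r so that the balls of radius r cannot
      meet, and no nearby zero is counted twice.\<close>
    have disj: "ball z0 r \<inter> ball z1 r = {}" if "z0 \<in> Z" "z1 \<in> Z" "z0 \<noteq> z1" for z0 z1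
    proof (rule ccontr)
      assume "ball z0 r \<inter> ball z1 r \<noteq> {}"
      then obtain w where "dist z0 w < r" "dist z1 w < r" by auto
      then have "dist z0 z1 \<le> 2 * r" using dist_triangle2[of z0 z1 w] by simp
      with iso[OF that(1), of z1] that show False by (simp add: Z_def)
    qed
    \<comment> \<open>The compact region free of zeros of A. For small u it stays free of zeros of A
      - u B, so any zero outside the balls must have norm above 1 / r.\<close>
    define K where "K = cball 0 (1 / r) - (\<Union>z0\<in>Z. ball z0 r)"
    have "compact K" unfolding K_def by (intro compact_diff open_UN) auto
    moreover have "poly A z \<noteq> 0" if "z \<in> K" for z
      using that r by (auto simp: K_def Z_def)
    ultimately have ev_far: "\<forall>\<^sub>F u in nhds 0. \<forall>z\<in>K. norm (u * poly B z) < norm (poly A z)"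
      by (rule eventually_norm_poly_less)
    have ev_near: "\<forall>\<^sub>F u in nhds 0. \<forall>z0\<in>Z.
        (\<Sum>z\<in>{z \<in> ball z0 r. poly (A - smult u B) z = 0}. order z (A - smult u B)) = order z0 A"
      using iso r by (intro eventually_ball_finite finZ ballI sum_order_nearby_roots A0 r) (force simp: Z_def)
    from ev_far ev_near
    show "\<forall>\<^sub>F u in nhds 0. dist (preimage_sum f \<psi> (rsphere_param x u)) (preimage_sum f \<psi> x) < e"
    proof eventually_elim
      case (elim u)
      define R where "R = A - smult u B"
      define n where "n z = real (order z R)" for z
      define Near where "Near z0 = {z \<in> ball z0 r. poly R z = 0}" for z0
      define W where "W = {z. poly R z = 0}"
      define Far where "Far = W - (\<Union>z0\<in>Z. Near z0)"
      obtain c where c: "c \<noteq> 0" "R = smult c (num (rsphere_param x u))"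
        using num_param[of x u] by (auto simp: R_def A_def B_def)
      have R0: "R \<noteq> 0" and degR: "degree R \<le> d" using c num_nonzero degree_num by auto
      have finW: "finite W" unfolding W_def by (rule poly_roots_finite[OF R0])
      have finNear: "finite (Near z0)" for z0 by (rule finite_subset[OF _ finW]) (auto simp: Near_def W_def)
      have split: "(\<Sum>z\<in>W. g z) = (\<Sum>z0\<in>Z. \<Sum>z\<in>Near z0. g z) + (\<Sum>z\<in>Far. g z)" for g :: "complex \<Rightarrow> real"
      proof -
        have sub: "(\<Union>z0\<in>Z. Near z0) \<subseteq> W" by (auto simp: Near_def W_def)
        have "(\<Sum>z\<in>W. g z) = (\<Sum>z\<in>Far. g z) + (\<Sum>z\<in>(\<Union>z0\<in>Z. Near z0). g z)"
          unfolding Far_def by (rule sum.subset_diff[OF sub finW])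
        also have "(\<Sum>z\<in>(\<Union>z0\<in>Z. Near z0). g z) = (\<Sum>z0\<in>Z. \<Sum>z\<in>Near z0. g z)"
          using disj finNear by (intro sum.UNION_disjoint finZ) (force simp: Near_def)+
        finally show ?thesis by simp
      qed
      have near_sum: "(\<Sum>z\<in>Near z0. n z) = order z0 A" if "z0 \<in> Z" for z0
        using elim(2) that unfolding n_def Near_def R_def by (metis of_nat_sum)
      have sumW: "(\<Sum>z\<in>W. n z) = degree R"
        using sum_order_roots[OF R0] unfolding n_def W_def by (metis of_nat_sum)
      have sumA: "(\<Sum>z\<in>Z. real (order z A)) = degree A"
        using sum_order_roots[OF A0] unfolding Z_def by (metis of_nat_sum)
      \<comment> \<open>These zeros have escaped towards infinity. Together with the multiplicity
        \<open>d - degree R\<close> of infinity itself they account for \<open>d - degree A\<close>,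
        the multiplicity of infinity over x.\<close>
      have sumFar: "(\<Sum>z\<in>Far. n z) = real (degree R) - real (degree A)"
        using split[of n] near_sum sumA sumW by simp
      have norm_far: "norm z > 1 / r" if "z \<in> Far" for z
      proof (rule ccontr)
        assume "\<not> norm z > 1 / r"
        with that have "z \<in> K" by (auto simp: Far_def K_def Near_def W_def)
        with elim(1) have "norm (u * poly B z) < norm (poly A z)" by blast
        moreover have "poly A z = u * poly B z" using that by (simp add: Far_def W_def R_def)
        ultimately show False by simp
      qed
      have eqx: "preimage_sum f \<psi> x = (\<Sum>z\<in>Z. real (order z A) * \<psi> (Some z)) + (real d - real (degree A)) * \<psi> None"
        using degA by (simp add: preimage_sum_f A_def Z_def of_nat_diff)
      have "preimage_sum f \<psi> (rsphere_param x u) = (\<Sum>z\<in>W. n z * \<psi> (Some z)) + (real d - real (degree R)) * \<psi> None"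
        using c degree_num[of "rsphere_param x u"]
        by (simp add: preimage_sum_f n_def W_def order_smult of_nat_diff)
      also have "(\<Sum>z\<in>W. n z * \<psi> (Some z)) =
          (\<Sum>z0\<in>Z. \<Sum>z\<in>Near z0. n z * \<psi> (Some z)) + (\<Sum>z\<in>Far. n z * \<psi> (Some z))"
        by (rule split)
      \<comment> \<open>Each value of \<psi> is compared with its value at the limit point; by the
        multiplicity counts the main terms reproduce the sum over the fibre of x and cancel.\<close>
      also have "(\<Sum>z0\<in>Z. \<Sum>z\<in>Near z0. n z * \<psi> (Some z)) =
          (\<Sum>z0\<in>Z. \<Sum>z\<in>Near z0. n z * (\<psi> (Some z) - \<psi> (Some z0))) + (\<Sum>z0\<in>Z. real (order z0 A) * \<psi> (Some z0))"
        by (simp add: right_diff_distrib sum_subtractf sum_distrib_right[symmetric] near_sum)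
      also have "(\<Sum>z\<in>Far. n z * \<psi> (Some z)) =
          (\<Sum>z\<in>Far. n z * (\<psi> (Some z) - \<psi> None)) + (real (degree R) - real (degree A)) * \<psi> None"
        by (simp add: right_diff_distrib sum_subtractf sum_distrib_right[symmetric] sumFar)
      finally have diff: "preimage_sum f \<psi> (rsphere_param x u) - preimage_sum f \<psi> x =
          (\<Sum>z0\<in>Z. \<Sum>z\<in>Near z0. n z * (\<psi> (Some z) - \<psi> (Some z0))) + (\<Sum>z\<in>Far. n z * (\<psi> (Some z) - \<psi> None))"
        unfolding eqx by (simp add: algebra_simps)
      have "\<bar>preimage_sum f \<psi> (rsphere_param x u) - preimage_sum f \<psi> x\<bar> \<le>
          (\<Sum>z0\<in>Z. \<Sum>z\<in>Near z0. n z * \<epsilon>) + (\<Sum>z\<in>Far. n z * \<epsilon>)"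
        unfolding diff
      proof (intro order_trans[OF abs_triangle_ineq] add_mono order_trans[OF sum_abs] sum_mono)
        fix z0 z assume "z0 \<in> Z" "z \<in> Near z0"
        then show "\<bar>n z * (\<psi> (Some z) - \<psi> (Some z0))\<bar> \<le> n z * \<epsilon>"
          using near[of z0 z] by (auto simp: Near_def abs_mult n_def intro!: mult_left_mono)
      next
        fix z assume "z \<in> Far"
        then show "\<bar>n z * (\<psi> (Some z) - \<psi> None)\<bar> \<le> n z * \<epsilon>"
          using less_imp_le[OF far[OF norm_far]] by (auto simp: abs_mult n_def intro!: mult_left_mono)
      qed
      also have "\<dots> = (\<Sum>z\<in>W. n z) * \<epsilon>"
        by (subst split) (simp add: sum_distrib_right distrib_right)
      also have "\<dots> \<le> d * \<epsilon>" using \<epsilon> degR by (simp add: sumW)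
      also have "\<dots> < e" using e by (simp add: \<epsilon>_def field_simps)
      finally show ?case by (simp add: dist_real_def)
    qed
  qed
  then show "isCont (\<lambda>w. preimage_sum f \<psi> (rsphere_param x w)) 0"
    using tendsto_at_iff_tendsto_nhds[of "\<lambda>w. preimage_sum f \<psi> (rsphere_param x w)" 0]
    by (simp add: isCont_def)
qed

section \<open>Local degrees and fibres of the iterates\<close>

lemma has_local_degree_funpow:
  "has_local_degree (f ^^ n) y (local_degree (f ^^ n) y) \<and> local_degree (f ^^ n) y > 0"
proof (induction n arbitrary: y)
  case 0
  show ?case using has_local_degree_ident[of y] has_local_degree_imp_local_degree[OF has_local_degree_ident, of y]
    by simp
next
  case (Suc n)
  have deg: "has_local_degree (f ^^ Suc n) y (local_degree f y * local_degree (f ^^ n) (f y))"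
    unfolding funpow_Suc_right
    using Suc[of "f y"] by (intro has_local_degree_compose has_local_degree_f local_degree_pos) auto
  show ?case
    unfolding has_local_degree_imp_local_degree[OF deg]
    using Suc[of "f y"] local_degree_pos[of y] by (intro conjI deg) simp
qed

lemma finite_vimage_funpow: "finite ((f ^^ n) -` {x})"
proof (induction n)
  case (Suc n)
  have "(f ^^ Suc n) -` {x} = (\<Union>z\<in>(f ^^ n) -` {x}. f -` {z})"
    unfolding funpow_Suc_right by auto
  also have "finite \<dots>" using Suc finite_vimage_f by (intro finite_UN_I)
  finally show ?case .
qed (auto simp: vimage_def)

lemma preimage_sum_funpow_Suc:
  "preimage_sum (f ^^ Suc n) \<psi> x = preimage_sum (f ^^ n) (preimage_sum f \<psi>) x"
  for \<psi> :: "rsphere \<Rightarrow> 'b::real_vector"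
  unfolding funpow_Suc_right
  by (intro preimage_sum_compose has_local_degree_f local_degree_pos finite_vimage_f finite_vimage_funpow
      has_local_degree_funpow[THEN conjunct1])

end

section \<open>The transfer operator and its invariant measure\<close>

context ratmap
begin

definition transfer :: "(rsphere \<Rightarrow> real) \<Rightarrow> rsphere \<Rightarrow> real" where
  "transfer g x = preimage_sum f g x / d"

lemma transfer_eq_sum: "transfer g x = (\<Sum>y\<in>f -` {x}. g y * (local_degree f y / d))"
  by (simp add: transfer_def preimage_sum_def sum_divide_distrib mult.commute)

lemma transfer_const: "transfer (\<lambda>_. c) = (\<lambda>_. c)"
  using d_ge_2 by (auto simp: transfer_def preimage_sum_const)

lemma transfer_add: "transfer (\<lambda>x. g x + h x) = (\<lambda>x. transfer g x + transfer h x)"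
  by (rule ext) (simp add: transfer_eq_sum distrib_right add_divide_distrib sum.distrib)

lemma transfer_scale: "transfer (\<lambda>x. c * g x) = (\<lambda>x. c * transfer g x)"
  by (rule ext) (simp add: transfer_eq_sum sum_distrib_left mult.assoc)

lemma transfer_diff: "transfer (\<lambda>x. g x - h x) = (\<lambda>x. transfer g x - transfer h x)"
  by (rule ext) (simp add: transfer_eq_sum left_diff_distrib diff_divide_distrib sum_subtractf)

lemma transfer_mono: "(\<And>x. g x \<le> h x) \<Longrightarrow> transfer g x \<le> transfer h x"
  unfolding transfer_eq_sum by (intro sum_mono mult_right_mono) auto

lemma transfer_nonneg: "(\<And>x. 0 \<le> g x) \<Longrightarrow> 0 \<le> transfer g x"
  using transfer_mono[of "\<lambda>_. 0" g x] by (simp add: transfer_const)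

lemma transfer_LIMSEQ:
  "(\<And>x. (\<lambda>k. \<psi> k x) \<longlonglongrightarrow> g x) \<Longrightarrow> (\<lambda>k. transfer (\<psi> k) x) \<longlonglongrightarrow> transfer g x"
  unfolding transfer_eq_sum by (intro tendsto_intros)

lemma continuous_transfer:
  "continuous_map rsphere_top euclideanreal \<psi> \<Longrightarrow> continuous_map rsphere_top euclideanreal (transfer \<psi>)"
  unfolding transfer_def
  by (intro continuous_map_real_divide continuous_preimage_sum) (use d_ge_2 in auto)

text \<open>Identifies the terms averaged in the theorem, and those in the definition of \<mu>, with
  an orbit of the operator \<open>transfer\<close>.\<close>

lemma funpow_transfer: "(transfer ^^ n) \<psi> x = preimage_sum (f ^^ n) \<psi> x / d ^ n"
proof (induction n arbitrary: \<psi> x)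
  case 0
  show ?case by (simp add: preimage_sum_ident)
next
  case (Suc n)
  have "(transfer ^^ Suc n) \<psi> x = (transfer ^^ n) (transfer \<psi>) x"
    by (simp add: funpow_swap1)
  also have "\<dots> = preimage_sum (f ^^ n) (transfer \<psi>) x / d ^ n" by (rule Suc)
  also have "transfer \<psi> = (\<lambda>x. (1 / d) *\<^sub>R preimage_sum f \<psi> x)"
    by (rule ext) (simp add: transfer_def)
  also have "preimage_sum (f ^^ n) (\<lambda>x. (1 / d) *\<^sub>R preimage_sum f \<psi> x) x = preimage_sum (f ^^ Suc n) \<psi> x / d"
    unfolding preimage_sum_funpow_Suc
    by (simp add: preimage_sum_def[of "f ^^ n"] sum_divide_distrib)
  finally show ?case by (simp only: power_Suc divide_divide_eq_left of_nat_mult)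
qed

text \<open>The weights add up to 1 because every fibre has d points with multiplicity. Viewing
  \<open>transfer\<close> as integration against a probability kernel gives access to measurability
  and to the action on measures by \<open>bind\<close>.\<close>

definition kernel_pmf :: "rsphere \<Rightarrow> rsphere pmf" where
  "kernel_pmf x = embed_pmf (\<lambda>y. if f y = x then local_degree f y / d else 0)"

lemma pmf_kernel: "pmf (kernel_pmf x) y = (if f y = x then local_degree f y / d else 0)"
  unfolding kernel_pmf_def
proof (rule pmf_embed_pmf)
  have "(\<integral>\<^sup>+ y. ennreal (if f y = x then local_degree f y / d else 0) \<partial>count_space UNIV) =
      (\<Sum>y\<in>f -` {x}. ennreal (if f y = x then local_degree f y / d else 0))"
    by (intro nn_integral_count_space' finite_vimage_f) auto
  also have "\<dots> = ennreal (transfer (\<lambda>_. 1) x)"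
    by (subst sum_ennreal) (auto simp: transfer_eq_sum intro!: sum.cong)
  finally show "(\<integral>\<^sup>+ y. ennreal (if f y = x then local_degree f y / d else 0) \<partial>count_space UNIV) = 1"
    by (simp add: transfer_const)
qed simp

text \<open>A \<open>pmf\<close> lives on the discrete sigma-algebra; the push-forward under the
  identity restricts it to the Borel sets, on which dependence on x can be measurable.\<close>

definition kernel :: "rsphere \<Rightarrow> rsphere measure" where
  "kernel x = distr (measure_pmf (kernel_pmf x)) rsphere_borel (\<lambda>y. y)"

lemma sets_kernel [simp]: "sets (kernel x) = sets rsphere_borel"
  by (simp add: kernel_def)

lemma prob_space_kernel: "prob_space (kernel x)"
  unfolding kernel_def by (intro prob_space.prob_space_distr prob_space_measure_pmf) simp

lemma set_pmf_kernel: "set_pmf (kernel_pmf x) \<subseteq> f -` {x}"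
  by (auto simp: set_pmf_eq pmf_kernel)

lemma integral_kernel:
  fixes g :: "rsphere \<Rightarrow> real"
  assumes "g \<in> borel_measurable rsphere_borel"
  shows "(\<integral>y. g y \<partial>kernel x) = transfer g x"
proof -
  have "(\<integral>y. g y \<partial>kernel x) = (\<integral>y. g y \<partial>measure_pmf (kernel_pmf x))"
    unfolding kernel_def by (rule integral_distr) (use assms in simp_all)
  also have "\<dots> = (\<Sum>y\<in>f -` {x}. g y * pmf (kernel_pmf x) y)"
    using set_pmf_kernel by (intro integral_measure_pmf_real finite_vimage_f) auto
  also have "\<dots> = transfer g x"
    unfolding transfer_eq_sum by (intro sum.cong) (auto simp: pmf_kernel)
  finally show ?thesis .
qed

lemma nn_integral_kernel:
  fixes g :: "rsphere \<Rightarrow> real"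
  assumes "g \<in> borel_measurable rsphere_borel" and nonneg: "\<And>x. 0 \<le> g x"
  shows "(\<integral>\<^sup>+y. ennreal (g y) \<partial>kernel x) = ennreal (transfer g x)"
proof -
  have "(\<integral>\<^sup>+y. ennreal (g y) \<partial>kernel x) = (\<integral>\<^sup>+y. ennreal (g y) \<partial>measure_pmf (kernel_pmf x))"
    unfolding kernel_def by (rule nn_integral_distr) (use assms in simp_all)
  also have "\<dots> = (\<Sum>y\<in>f -` {x}. ennreal (g y) * ennreal (pmf (kernel_pmf x) y))"
    using set_pmf_kernel by (intro nn_integral_measure_pmf_support finite_vimage_f) auto
  also have "\<dots> = (\<Sum>y\<in>f -` {x}. ennreal (g y * (local_degree f y / d)))"
    by (intro sum.cong) (auto simp: pmf_kernel ennreal_mult[symmetric] nonneg)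
  also have "\<dots> = ennreal (transfer g x)"
    unfolding transfer_eq_sum by (intro sum_ennreal) (simp add: nonneg)
  finally show ?thesis .
qed

lemma emeasure_kernel:
  assumes "A \<in> sets rsphere_borel"
  shows "emeasure (kernel x) A = ennreal (transfer (indicator A) x)"
proof -
  have "emeasure (kernel x) A = (\<integral>\<^sup>+y. indicator A y \<partial>kernel x)"
    using assms by simp
  also have "\<dots> = (\<integral>\<^sup>+y. ennreal (indicator A y) \<partial>kernel x)"
    by (intro nn_integral_cong) (simp split: split_indicator)
  also have "\<dots> = ennreal (transfer (indicator A) x)"
    using assms by (intro nn_integral_kernel) auto
  finally show ?thesis .
qed

text \<open>\<open>transfer\<close> maps the continuous approximants of the indicator to continuous
  functions, and as a finite sum it commutes with the pointwise limit.\<close>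

lemma transfer_indicator_basis_measurable:
  assumes "A \<in> rsphere_basis"
  shows "transfer (indicator A) \<in> borel_measurable rsphere_borel"
proof -
  obtain \<psi> :: "nat \<Rightarrow> rsphere \<Rightarrow> real" where \<psi>:
    "\<And>k. continuous_map rsphere_top euclideanreal (\<psi> k)"
    "\<And>x. (\<lambda>k. \<psi> k x) \<longlonglongrightarrow> indicator A x"
    using assms by (rule rsphere_basis_approx) (rule that)
  show ?thesis
  proof (rule borel_measurable_LIMSEQ_real)
    show "(\<lambda>k. transfer (\<psi> k) x) \<longlonglongrightarrow> transfer (indicator A) x" for x
      by (rule transfer_LIMSEQ) (rule \<psi>(2))
    show "transfer (\<psi> k) \<in> borel_measurable rsphere_borel" for k
      by (rule borel_measurable_rsphere_continuous[OF continuous_transfer[OF \<psi>(1)]])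
  qed
qed

lemma rsphere_basis_sets: "A \<in> rsphere_basis \<Longrightarrow> A \<in> sets rsphere_borel"
  by (simp add: sets_rsphere_borel_eq)

text \<open>A family of probability measures depends measurably on its parameter as soon as the
  masses of the sets of an intersection-stable generator do.\<close>

lemma kernel_measurable: "kernel \<in> measurable rsphere_borel (subprob_algebra rsphere_borel)"
proof -
  have "kernel \<in> measurable rsphere_borel (prob_algebra rsphere_borel)"
  proof (rule measurable_prob_algebra_generated[OF sets_rsphere_borel_eq Int_stable_rsphere_basis])
    show "prob_space (kernel x)" for x by (rule prob_space_kernel)
    show "(\<lambda>x. emeasure (kernel x) A) \<in> borel_measurable rsphere_borel" if "A \<in> rsphere_basis" for A
      using transfer_indicator_basis_measurable[OF that]
      by (simp add: emeasure_kernel rsphere_basis_sets that)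
  qed simp_all
  then show ?thesis by (rule measurable_prob_algebraD)
qed

end

section \<open>Invariance of the limit measure under the kernel\<close>

locale ratmap_FLML = ratmap +
  fixes \<mu> :: "rsphere measure"
  assumes FLML: "FLML_measure d f \<mu>"
begin

lemma sets_\<mu>: "sets \<mu> = sets rsphere_borel"
  using FLML by (simp add: FLML_measure_def)

sublocale prob_space \<mu>
  using FLML by (simp add: FLML_measure_def)

lemma space_\<mu>: "space \<mu> = UNIV"
  using sets_eq_imp_space_eq[OF sets_\<mu>] by simp

lemma measurable_\<mu>: "borel_measurable \<mu> = borel_measurable rsphere_borel"
  by (rule measurable_cong_sets[OF sets_\<mu> refl])

lemma weak_limit:
  "\<exists>E. finite E \<and> (\<forall>a \<psi>. a \<notin> E \<longrightarrow> continuous_map rsphere_top euclideanreal \<psi> \<longrightarrow>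
      (\<lambda>n. (transfer ^^ n) \<psi> a) \<longlonglongrightarrow> (\<integral>y. \<psi> y \<partial>\<mu>))"
  using FLML unfolding FLML_measure_def funpow_transfer by auto

lemma integrable_continuous:
  fixes \<psi> :: "rsphere \<Rightarrow> real"
  assumes "continuous_map rsphere_top euclideanreal \<psi>"
  shows "integrable \<mu> \<psi>"
proof -
  obtain B where "\<And>x. \<bar>\<psi> x\<bar> \<le> B" using continuous_map_rsphere_bounded[OF assms] by blast
  then show ?thesis
    using borel_measurable_rsphere_continuous[OF assms]
    by (intro integrable_const_bound[of _ B]) (auto simp: measurable_\<mu>)
qed

lemma infinite_rsphere: "infinite (UNIV :: rsphere set)"
  using finite_option_UNIV infinite_UNIV_char_0[where 'a = complex] by blast

lemma integral_transfer_continuous: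
  assumes \<psi>: "continuous_map rsphere_top euclideanreal \<psi>"
  shows "(\<integral>x. transfer \<psi> x \<partial>\<mu>) = (\<integral>x. \<psi> x \<partial>\<mu>)"
proof -
  obtain E where E: "finite E"
    "\<And>a \<psi>. a \<notin> E \<Longrightarrow> continuous_map rsphere_top euclideanreal \<psi> \<Longrightarrow>
      (\<lambda>n. (transfer ^^ n) \<psi> a) \<longlonglongrightarrow> (\<integral>y. \<psi> y \<partial>\<mu>)"
    using weak_limit by auto
  obtain a where a: "a \<notin> E" using ex_new_if_finite[OF infinite_rsphere E(1)] by blast
  have "(\<lambda>n. (transfer ^^ n) (transfer \<psi>) a) \<longlonglongrightarrow> (\<integral>y. transfer \<psi> y \<partial>\<mu>)"
    by (intro E(2) a continuous_transfer \<psi>)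
  moreover have "(\<lambda>n. (transfer ^^ Suc n) \<psi> a) \<longlonglongrightarrow> (\<integral>y. \<psi> y \<partial>\<mu>)"
    by (intro LIMSEQ_Suc E(2) a \<psi>)
  ultimately show ?thesis
    unfolding funpow_Suc_right comp_def by (rule LIMSEQ_unique)
qed

lemma kernel_measurable_\<mu>: "kernel \<in> measurable \<mu> (subprob_algebra rsphere_borel)"
  using kernel_measurable by (simp add: measurable_cong_sets[OF sets_\<mu> refl])

text \<open>Invariance for continuous functions passes to the indicators of
  \<open>rsphere_basis\<close> by dominated convergence, and then to all Borel sets by uniqueness of
  measures. \<open>UNIV\<close> is added to the generator because uniqueness asks for a countable
  cover by generators, while the basis sets all miss infinity; on it both measures have mass
  1.\<close>

lemma bind_kernel: "\<mu> \<bind> kernel = \<mu>"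
proof (rule measure_eqI_generator_eq[where A = "\<lambda>_. UNIV" and E = "insert UNIV rsphere_basis" and \<Omega> = UNIV])
  have ne: "space \<mu> \<noteq> {}" by (simp add: space_\<mu>)
  interpret B: prob_space "\<mu> \<bind> kernel"
    by (rule prob_space_bind[OF _ kernel_measurable_\<mu>]) (simp add: prob_space_kernel)
  have sets_bind: "sets (\<mu> \<bind> kernel) = sets rsphere_borel"
    by (rule sets_bind[OF _ ne]) simp
  have gen: "sigma_sets UNIV (insert UNIV rsphere_basis) = sets rsphere_borel"
    unfolding sets_rsphere_borel_eq
  proof (rule antisym)
    show "sigma_sets UNIV (insert UNIV rsphere_basis) \<subseteq> sigma_sets UNIV rsphere_basis"
      by (rule sigma_sets_mono) (auto intro: sigma_sets_top)
    show "sigma_sets UNIV rsphere_basis \<subseteq> sigma_sets UNIV (insert UNIV rsphere_basis)"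
      by (rule sigma_sets_mono') auto
  qed
  show "sets (\<mu> \<bind> kernel) = sigma_sets UNIV (insert UNIV rsphere_basis)"
    "sets \<mu> = sigma_sets UNIV (insert UNIV rsphere_basis)"
    by (simp_all add: gen sets_bind sets_\<mu>)
  show "emeasure (\<mu> \<bind> kernel) UNIV \<noteq> \<infinity>" by (simp add: B.emeasure_eq_measure)
  show "Int_stable (insert UNIV rsphere_basis)"
    using Int_stable_rsphere_basis by (auto simp: Int_stable_def)
  fix A assume A: "A \<in> insert UNIV rsphere_basis"
  show "emeasure (\<mu> \<bind> kernel) A = emeasure \<mu> A"
  proof (cases "A = UNIV")
    case True
    have "space (\<mu> \<bind> kernel) = UNIV" using sets_eq_imp_space_eq[OF sets_bind] by simp
    then show ?thesis using B.emeasure_space_1 emeasure_space_1 True by (simp add: space_\<mu>)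
  next
    case False
    with A have A: "A \<in> rsphere_basis" by simp
    note A' = rsphere_basis_sets[OF A]
    obtain \<psi> :: "nat \<Rightarrow> rsphere \<Rightarrow> real" where \<psi>:
      "\<And>k. continuous_map rsphere_top euclideanreal (\<psi> k)" "\<And>k x. \<psi> k x \<in> {0..1}"
      "\<And>x. (\<lambda>k. \<psi> k x) \<longlonglongrightarrow> indicator A x"
      using A by (rule rsphere_basis_approx) (rule that)
    have bd: "norm (\<psi> k x) \<le> 1" for k x using \<psi>(2)[of k x] by simp
    have bdT: "norm (transfer (\<psi> k) x) \<le> 1" for k x
      using transfer_mono[of "\<psi> k" "\<lambda>_. 1" x] transfer_nonneg[of "\<psi> k" x] \<psi>(2)[of k]
      by (simp add: transfer_const)
    have 1: "(\<lambda>k. \<integral>x. \<psi> k x \<partial>\<mu>) \<longlonglongrightarrow> (\<integral>x. indicator A x \<partial>\<mu>)"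
      by (rule integral_dominated_convergence[where w = "\<lambda>_. 1"])
        (use \<psi>(3) bd A' borel_measurable_rsphere_continuous[OF \<psi>(1)] in \<open>auto simp: measurable_\<mu>\<close>)
    have 2: "(\<lambda>k. \<integral>x. transfer (\<psi> k) x \<partial>\<mu>) \<longlonglongrightarrow> (\<integral>x. transfer (indicator A) x \<partial>\<mu>)"
    proof (rule integral_dominated_convergence[where w = "\<lambda>_. 1"])
      show "transfer (indicator A) \<in> borel_measurable \<mu>"
        using transfer_indicator_basis_measurable[OF A] by (simp add: measurable_\<mu>)
      show "transfer (\<psi> k) \<in> borel_measurable \<mu>" for k
        using borel_measurable_rsphere_continuous[OF continuous_transfer[OF \<psi>(1)]] by (simp add: measurable_\<mu>)
      show "AE x in \<mu>. (\<lambda>k. transfer (\<psi> k) x) \<longlonglongrightarrow> transfer (indicator A) x"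
        by (rule AE_I2, rule transfer_LIMSEQ) (rule \<psi>(3))
    qed (use bdT in auto)
    \<comment> \<open>Along the approximants both integrals agree term by term, so the two limits
      coincide.\<close>
    have eq: "(\<integral>x. transfer (indicator A) x \<partial>\<mu>) = (\<integral>x. indicator A x \<partial>\<mu>)"
      using LIMSEQ_unique[OF 1] 2 integral_transfer_continuous[OF \<psi>(1)] by simp
    have ind01: "0 \<le> transfer (indicator A) x" "transfer (indicator A) x \<le> 1" for x
      using transfer_mono[of "indicator A" "\<lambda>_. 1" x] transfer_nonneg[of "indicator A" x]
      by (simp_all add: transfer_const indicator_def)
    have "emeasure (\<mu> \<bind> kernel) A = (\<integral>\<^sup>+x. emeasure (kernel x) A \<partial>\<mu>)"
      by (rule emeasure_bind[OF ne kernel_measurable_\<mu> A'])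
    also have "\<dots> = (\<integral>\<^sup>+x. ennreal (transfer (indicator A) x) \<partial>\<mu>)"
      by (simp add: emeasure_kernel[OF A'])
    also have "\<dots> = ennreal (\<integral>x. transfer (indicator A) x \<partial>\<mu>)"
      using ind01 transfer_indicator_basis_measurable[OF A]
      by (intro nn_integral_eq_integral integrable_const_bound[of _ 1]) (auto simp: measurable_\<mu>)
    also have "\<dots> = emeasure \<mu> A"
      using A' by (simp add: eq emeasure_eq_measure sets_\<mu>)
    finally show ?thesis .
  qed
qed simp_all

text \<open>Measurability is inherited from the kernel: integrating a fixed Borel function is a
  measurable operation on the space of subprobability measures.\<close>

lemma measurable_transfer:
  assumes "g \<in> borel_measurable \<mu>"
  shows "transfer g \<in> borel_measurable \<mu>"
proof -
  have g: "g \<in> borel_measurable rsphere_borel" using assms by (simp add: measurable_\<mu>)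
  have "(\<lambda>x. \<integral>y. g y \<partial>kernel x) \<in> borel_measurable \<mu>"
    by (rule measurable_compose[OF kernel_measurable_\<mu> integral_measurable_subprob_algebra[OF g]])
  then show ?thesis by (simp add: integral_kernel[OF g])
qed

lemma nn_integral_transfer:
  assumes g: "g \<in> borel_measurable \<mu>" and nonneg: "\<And>x. 0 \<le> g x"
  shows "(\<integral>\<^sup>+x. ennreal (transfer g x) \<partial>\<mu>) = (\<integral>\<^sup>+x. ennreal (g x) \<partial>\<mu>)"
proof -
  have g': "g \<in> borel_measurable rsphere_borel" using g by (simp add: measurable_\<mu>)
  have "(\<integral>\<^sup>+x. ennreal (g x) \<partial>\<mu>) = (\<integral>\<^sup>+x. ennreal (g x) \<partial>(\<mu> \<bind> kernel))"
    by (simp add: bind_kernel)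
  also have "\<dots> = (\<integral>\<^sup>+x. \<integral>\<^sup>+y. ennreal (g y) \<partial>kernel x \<partial>\<mu>)"
    using g' by (intro nn_integral_bind[OF _ kernel_measurable_\<mu>]) simp
  also have "\<dots> = (\<integral>\<^sup>+x. ennreal (transfer g x) \<partial>\<mu>)"
    by (simp add: nn_integral_kernel[OF g' nonneg])
  finally show ?thesis by simp
qed

lemma transfer_integral_nonneg:
  assumes g: "integrable \<mu> g" and nonneg: "\<And>x. 0 \<le> g x"
  shows "integrable \<mu> (transfer g) \<and> (\<integral>x. transfer g x \<partial>\<mu>) = (\<integral>x. g x \<partial>\<mu>)"
proof -
  have gm: "g \<in> borel_measurable \<mu>" using g by simp
  have eq: "(\<integral>\<^sup>+x. ennreal (transfer g x) \<partial>\<mu>) = ennreal (\<integral>x. g x \<partial>\<mu>)"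
    using nn_integral_transfer[OF gm nonneg] nn_integral_eq_integral[OF g] nonneg by simp
  have "has_bochner_integral \<mu> (transfer g) (\<integral>x. g x \<partial>\<mu>)"
    using eq nonneg measurable_transfer[OF gm]
    by (intro has_bochner_integral_nn_integral) (auto intro: transfer_nonneg integral_nonneg_AE)
  then show ?thesis by (simp add: has_bochner_integral_iff)
qed

sublocale markov_operator \<mu> transfer
proof
  show "transfer (\<lambda>x. g x + h x) = (\<lambda>x. transfer g x + transfer h x)" for g h by (rule transfer_add)
  show "transfer (\<lambda>x. c * g x) = (\<lambda>x. c * transfer g x)" for c g by (rule transfer_scale)
  show "transfer (\<lambda>x. 1) = (\<lambda>x. 1)" by (rule transfer_const)
  show "transfer g x \<le> transfer h x" if "\<And>x. g x \<le> h x" for g h x using that by (rule transfer_mono)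
  have "integrable \<mu> (transfer g) \<and> (\<integral>x. transfer g x \<partial>\<mu>) = (\<integral>x. g x \<partial>\<mu>)" if g: "integrable \<mu> g" for g
  proof -
    have 1: "integrable \<mu> (\<lambda>x. max 0 (g x))" and 2: "integrable \<mu> (\<lambda>x. max 0 (- g x))"
      using g by (auto intro: Bochner_Integration.integrable_max)
    have eq: "g = (\<lambda>x. max 0 (g x) - max 0 (- g x))" by auto
    have "transfer g = (\<lambda>x. transfer (\<lambda>x. max 0 (g x)) x - transfer (\<lambda>x. max 0 (- g x)) x)"
      by (subst eq) (rule transfer_diff)
    moreover have "(\<integral>x. g x \<partial>\<mu>) = (\<integral>x. max 0 (g x) \<partial>\<mu>) - (\<integral>x. max 0 (- g x) \<partial>\<mu>)"
      by (subst eq) (rule Bochner_Integration.integral_diff[OF 1 2])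
    ultimately show ?thesis
      using transfer_integral_nonneg[OF 1] transfer_integral_nonneg[OF 2] by simp
  qed
  then show "integrable \<mu> g \<Longrightarrow> integrable \<mu> (transfer g)"
    "integrable \<mu> g \<Longrightarrow> (\<integral>x. transfer g x \<partial>\<mu>) = (\<integral>x. g x \<partial>\<mu>)" for g by auto
qed

text \<open>The operator maps the indicator of y to a multiple of the indicator of
  \<open>f y\<close>, and it preserves the integral. Since local degrees are at most d, atoms never
  get lighter along f.\<close>

lemma measure_singleton: "measure \<mu> {y} = local_degree f y / d * measure \<mu> {f y}"
proof -
  have s: "{z} \<in> sets \<mu>" for z by (simp add: sets_\<mu> sets_rsphere_borel_singleton)
  have "transfer (indicator {y}) = (\<lambda>x. local_degree f y / d * indicator {f y} x)"
  proof
    fix x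
    have "transfer (indicator {y}) x = (\<Sum>z\<in>f -` {x}. if z = y then local_degree f y / d else 0)"
      unfolding transfer_eq_sum by (intro sum.cong) (auto simp: indicator_def)
    then show "transfer (indicator {y}) x = local_degree f y / d * indicator {f y} x"
      using finite_vimage_f[of x] by (simp add: sum.delta indicator_def)
  qed
  moreover have "(\<integral>x. transfer (indicator {y}) x \<partial>\<mu>) = (\<integral>x. indicator {y} x \<partial>\<mu>)"
    using s by (intro T_integral) (simp add: less_top[symmetric])
  ultimately show ?thesis using s by simp
qed

end

section \<open>Absence of atoms and convergence of the averages\<close>

lemma openin_param_ball:
  assumes "\<delta> > 0"
  shows "openin rsphere_top (rsphere_param s ` ball 0 \<delta>)"
proof (cases s)
  case (Some c)
  have "rsphere_param s ` ball 0 \<delta> = Some ` ball c \<delta>"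
  proof (intro equalityI subsetI)
    fix x assume "x \<in> Some ` ball c \<delta>"
    then obtain z where "x = Some z" "dist c z < \<delta>" by auto
    then show "x \<in> rsphere_param s ` ball 0 \<delta>"
      by (intro image_eqI[of _ _ "z - c"]) (auto simp: rsphere_param_def Some dist_norm norm_minus_commute)
  qed (auto simp: rsphere_param_def Some dist_norm)
  then show ?thesis by (simp add: rsphere_top_def)
next
  case None
  have "rsphere_param s ` ball 0 \<delta> = insert None (Some ` (topspace euclidean - cball (0::complex) (1 / \<delta>)))"
  proof (intro equalityI subsetI)
    fix x assume x: "x \<in> insert None (Some ` (topspace euclidean - cball (0::complex) (1 / \<delta>)))"
    show "x \<in> rsphere_param s ` ball 0 \<delta>"
    proof (cases x)
      case None
      with \<open>s = None\<close> assms show ?thesis by (intro image_eqI[of _ _ 0]) (auto simp: rsphere_param_def)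
    next
      case (Some z)
      with x have z: "norm z > 1 / \<delta>" by auto
      then have "z \<noteq> 0" using assms by auto
      then show ?thesis using z assms \<open>s = None\<close> Some
        by (intro image_eqI[of _ _ "inverse z"])
          (auto simp: rsphere_param_def norm_inverse norm_divide field_simps)
    qed
  next
    fix x assume "x \<in> rsphere_param s ` ball 0 \<delta>"
    then obtain w where w: "norm w < \<delta>" "x = rsphere_param None w" using None by auto
    show "x \<in> insert None (Some ` (topspace euclidean - cball (0::complex) (1 / \<delta>)))"
      using w assms by (cases "w = 0") (auto simp: rsphere_param_def norm_inverse norm_divide field_simps)
  qed
  then show ?thesis
    unfolding rsphere_top_def openin_Alexandroff_compactification
    by (intro disjI2 exI[of _ "cball (0::complex) (1 / \<delta>)"]) auto
qed

text \<open>With n at least 2 a factor w can be split off such that the cofactor still tends to 0.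
  The estimate compares the charts at s and at \<open>g s\<close> with the same radius, so equal
  chart discs around an invariant finite set form a forward invariant set.\<close>

lemma has_local_degree_attracting:
  assumes g: "has_local_degree g s n" and n: "n \<ge> 2"
  shows "\<forall>\<^sub>F w in nhds 0. \<exists>v. g (rsphere_param s w) = rsphere_param (g s) v \<and> norm v \<le> norm w"
proof -
  from g obtain h where h: "h analytic_on {0}"
    and ev: "\<forall>\<^sub>F w in nhds 0. g (rsphere_param s w) = rsphere_param (g s) (w ^ n * h w)"
    by (auto simp: has_local_degree_def)
  define k where "k w = w ^ (n - 1) * h w" for w
  have "k analytic_on {0}" unfolding k_def by (intro analytic_intros h)
  then have "isCont k 0" by (rule analytic_at_imp_isCont)
  then have "(k \<longlongrightarrow> 0) (nhds 0)"
    using tendsto_at_iff_tendsto_nhds[of k 0] n by (simp add: isCont_def k_def zero_power)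
  from tendstoD[OF this, of 1] have "\<forall>\<^sub>F w in nhds 0. norm (k w) < 1" by simp
  with ev show ?thesis
  proof eventually_elim
    case (elim w)
    have "w ^ n * h w = w * k w" using n by (simp add: k_def power_eq_if)
    then have "norm (w ^ n * h w) \<le> norm w" using elim(2) by (simp add: norm_mult mult_left_le)
    with elim(1) show ?case by blast
  qed
qed

context ratmap_FLML
begin

text \<open>The quotient of the local degree by d is a single weight of a probability
  vector.\<close>

lemma local_degree_le: "local_degree f y \<le> d"
  using pmf_le_1[of "kernel_pmf (f y)" y] d_ge_2 by (simp add: pmf_kernel)

lemma sets_singleton: "{y} \<in> sets \<mu>"
  by (simp add: sets_\<mu> sets_rsphere_borel_singleton)

lemma finite_big_atoms:
  assumes "m > 0"
  shows "finite {y. measure \<mu> {y} \<ge> m}"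
proof -
  have "card G \<le> nat \<lfloor>1 / m\<rfloor>" if "G \<subseteq> {y. measure \<mu> {y} \<ge> m}" "finite G" for G
  proof -
    have "card G * m \<le> (\<Sum>y\<in>G. measure \<mu> {y})"
      using sum_mono[of G "\<lambda>_. m" "\<lambda>y. measure \<mu> {y}"] that by auto
    also have "\<dots> = measure \<mu> G"
      using that by (intro finite_measure_eq_sum_singleton[symmetric] sets_singleton)
    also have "\<dots> \<le> 1" by (rule prob_le_1)
    finally have "card G \<le> 1 / m" using assms by (simp add: field_simps)
    then show ?thesis by linarith
  qed
  then show ?thesis using finite_if_finite_subsets_card_bdd by blast
qed

text \<open>The atoms of maximal mass form a finite forward invariant set of points of local degree \<open>d\<close>.
  Such points are superattracting, so a neighbourhood of them is avoided by all
  preimages of a suitable base point, and hence is not charged by \<open>\<mu>\<close>.\<close>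

lemma measure_singleton_eq_0: "measure \<mu> {y} = 0"
proof (rule ccontr)
  assume "measure \<mu> {y} \<noteq> 0"
  then have pos: "measure \<mu> {y} > 0" by (simp add: zero_less_measure_iff)
  \<comment> \<open>Only finitely many atoms weigh at least as much as y, so a maximal mass m exists
    and is attained.\<close>
  define S0 where "S0 = {z. measure \<mu> {z} \<ge> measure \<mu> {y}}"
  have finS0: "finite S0" unfolding S0_def by (rule finite_big_atoms[OF pos])
  have yS0: "y \<in> S0" by (simp add: S0_def)
  define m where "m = Max ((\<lambda>z. measure \<mu> {z}) ` S0)"
  have "m \<in> (\<lambda>z. measure \<mu> {z}) ` S0" unfolding m_def using finS0 yS0 by (intro Max_in) auto
  then obtain s0 where s0: "measure \<mu> {s0} = m" by auto
  have m_ge: "measure \<mu> {z} \<le> m" if "z \<in> S0" for z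
    unfolding m_def using finS0 that by (intro Max_ge) auto
  have m_pos: "m > 0" using m_ge[OF yS0] pos by simp
  have le_m: "measure \<mu> {z} \<le> m" for z
    using m_ge[of z] m_ge[OF yS0] by (cases "z \<in> S0") (auto simp: S0_def)
  define S where "S = {z. measure \<mu> {z} = m}"
  have finS: "finite S"
    by (rule finite_subset[OF _ finite_big_atoms[OF m_pos]]) (auto simp: S_def)
  have S: "local_degree f s = d \<and> f s \<in> S" if "s \<in> S" for s
  proof -
    \<comment> \<open>The mass of \<open>f s\<close> is at most m and the weight in front at most 1,
      so both must be equalities.\<close>
    have eq: "m = local_degree f s / d * measure \<mu> {f s}"
      using that measure_singleton[of s] by (simp add: S_def)
    also have "\<dots> \<le> local_degree f s / d * m" by (intro mult_left_mono le_m) simp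
    finally have "1 * m \<le> local_degree f s / d * m" by simp
    then have "1 \<le> local_degree f s / d" using m_pos by (rule mult_right_le_imp_le)
    then have "local_degree f s = d" using local_degree_le[of s] d_ge_2 by (simp add: field_simps)
    with eq show ?thesis using d_ge_2 by (simp add: S_def)
  qed
  obtain E where E: "finite E"
    "\<And>a \<psi>. a \<notin> E \<Longrightarrow> continuous_map rsphere_top euclideanreal \<psi> \<Longrightarrow>
      (\<lambda>n. (transfer ^^ n) \<psi> a) \<longlonglongrightarrow> (\<integral>y. \<psi> y \<partial>\<mu>)"
    using weak_limit by auto
  \<comment> \<open>Outside E the weak limit is available at a; outside S small chart discs around
    the points of S miss a.\<close>
  obtain a where a: "a \<notin> S \<union> E"
    using ex_new_if_finite[OF infinite_rsphere, of "S \<union> E"] finS E(1) by auto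
  have "\<forall>\<^sub>F w in nhds 0. \<forall>s\<in>S. rsphere_param s w \<noteq> a \<and>
      (\<exists>v. f (rsphere_param s w) = rsphere_param (f s) v \<and> norm v \<le> norm w)"
  proof (intro eventually_ball_finite finS ballI eventually_conj)
    fix s assume s: "s \<in> S"
    have "openin rsphere_top (- {a})"
      using closedin_Hausdorff_singleton[OF Hausdorff_rsphere_top, of a]
      by (simp add: closedin_def Compl_eq_Diff_UNIV)
    moreover have "s \<in> - {a}" using s a by auto
    ultimately show "\<forall>\<^sub>F w in nhds 0. rsphere_param s w \<noteq> a"
      unfolding openin_rsphere_top_iff by fastforce
    show "\<forall>\<^sub>F w in nhds 0. \<exists>v. f (rsphere_param s w) = rsphere_param (f s) v \<and> norm v \<le> norm w"
      using has_local_degree_f[of s] S[OF s] d_ge_2 by (intro has_local_degree_attracting[where n = d]) auto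
  qed
  then obtain \<delta> where \<delta>: "\<delta> > 0" "\<And>s w. s \<in> S \<Longrightarrow> norm w < \<delta> \<Longrightarrow> rsphere_param s w \<noteq> a"
    "\<And>s w. s \<in> S \<Longrightarrow> norm w < \<delta> \<Longrightarrow> \<exists>v. f (rsphere_param s w) = rsphere_param (f s) v \<and> norm v \<le> norm w"
    unfolding eventually_nhds_metric by auto
  define U where "U = (\<Union>s\<in>S. rsphere_param s ` ball 0 \<delta>)"
  have fU: "f z \<in> U" if "z \<in> U" for z
  proof -
    from that obtain s w where sw: "s \<in> S" "norm w < \<delta>" "z = rsphere_param s w" by (auto simp: U_def)
    with \<delta>(3) obtain v where v: "f z = rsphere_param (f s) v" "norm v \<le> norm w" by blast
    then have "v \<in> ball 0 \<delta>" using sw by simp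
    with v(1) S[OF sw(1)] show ?thesis unfolding U_def by blast
  qed
  have fnU: "(f ^^ n) z \<in> U" if "z \<in> U" for n z
    by (induction n) (use that fU in auto)
  have aU: "a \<notin> U"
  proof
    assume "a \<in> U"
    then obtain s w where "s \<in> S" "norm w < \<delta>" "a = rsphere_param s w" by (auto simp: U_def)
    with \<delta>(2)[of s w] show False by simp
  qed
  have "s0 \<in> S" using s0 by (simp add: S_def)
  have "s0 \<in> rsphere_param s0 ` ball 0 \<delta>"
    using \<delta>(1) by (intro image_eqI[of _ _ 0]) auto
  then obtain \<psi> where \<psi>: "continuous_map rsphere_top euclideanreal \<psi>" "\<And>y. 0 \<le> \<psi> y" "\<psi> s0 = 1"
    "\<And>y. y \<notin> rsphere_param s0 ` ball 0 \<delta> \<Longrightarrow> \<psi> y = 0"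
    using rsphere_Urysohn[OF openin_param_ball[OF \<delta>(1)]] by metis
  \<comment> \<open>An orbit that starts in U stays in U and cannot reach a, so \<psi>, which is
    supported in U, vanishes on all preimages of a.\<close>
  have zero: "(transfer ^^ n) \<psi> a = 0" for n
  proof -
    have "\<psi> z = 0" if "(f ^^ n) z = a" for z
    proof -
      have "z \<notin> U" using fnU[of z n] that aU by auto
      then show ?thesis using \<open>s0 \<in> S\<close> by (intro \<psi>(4)) (auto simp: U_def)
    qed
    then show ?thesis by (simp add: funpow_transfer preimage_sum_def)
  qed
  have "(\<lambda>n. (transfer ^^ n) \<psi> a) \<longlonglongrightarrow> (\<integral>y. \<psi> y \<partial>\<mu>)"
    using a \<psi>(1) by (intro E(2)) auto
  then have "(\<integral>y. \<psi> y \<partial>\<mu>) = 0" unfolding zero by (simp add: LIMSEQ_const_iff)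
  moreover have "(\<integral>y. indicator {s0} y \<partial>\<mu>) \<le> (\<integral>y. \<psi> y \<partial>\<mu>)"
  proof (rule integral_mono)
    show "integrable \<mu> (indicator {s0} :: rsphere \<Rightarrow> real)"
      using sets_singleton by (simp add: less_top[symmetric])
    show "indicator {s0} y \<le> \<psi> y" for y
      using \<psi>(2)[of y] \<psi>(3) by (simp add: indicator_def)
  qed (rule integrable_continuous[OF \<psi>(1)])
  ultimately show False using s0 m_pos sets_singleton by simp
qed

theorem averages_AE_tendsto:
  fixes g :: "rsphere \<Rightarrow> real"
  assumes g: "integrable \<mu> g"
  shows "AE x in \<mu>. (\<lambda>n. birkhoff_sum n g x / n) \<longlonglongrightarrow> (\<integral>x. g x \<partial>\<mu>)"
proof (rule birkhoff_averages_AE_tendsto[where D = "{\<psi>. continuous_map rsphere_top euclideanreal \<psi>}"])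
  fix \<psi> :: "rsphere \<Rightarrow> real" assume \<psi>: "\<psi> \<in> {\<psi>. continuous_map rsphere_top euclideanreal \<psi>}"
  then show "integrable \<mu> \<psi>" by (intro integrable_continuous) simp
  obtain E where E: "finite E"
    "\<And>a \<psi>. a \<notin> E \<Longrightarrow> continuous_map rsphere_top euclideanreal \<psi> \<Longrightarrow>
      (\<lambda>n. (transfer ^^ n) \<psi> a) \<longlonglongrightarrow> (\<integral>y. \<psi> y \<partial>\<mu>)"
    using weak_limit by auto
  \<comment> \<open>Absence of atoms makes the finite exceptional set null, so convergence off E
    becomes convergence almost everywhere.\<close>
  have "AE x in \<mu>. x \<noteq> y" for y
    using measure_singleton_eq_0[of y] sets_singleton[of y]
    by (intro AE_I[of _ _ "{y}"]) (auto simp: emeasure_eq_measure)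
  then have "AE x in \<mu>. \<forall>y\<in>E. x \<noteq> y" by (intro AE_finite_allI E(1))
  then show "AE x in \<mu>. (\<lambda>n. (transfer ^^ n) \<psi> x) \<longlonglongrightarrow> (\<integral>x. \<psi> x \<partial>\<mu>)"
    by eventually_elim (use \<psi> in \<open>auto intro: E(2)\<close>)
next
  show "\<exists>\<psi>\<in>{\<psi>. continuous_map rsphere_top euclideanreal \<psi>}. (\<integral>x. \<bar>f x - \<psi> x\<bar> \<partial>\<mu>) < e"
    if "integrable \<mu> f" "e > 0" for f e
    using continuous_dense_L1_rsphere[OF finite_measure_axioms sets_\<mu> that] by auto
qed (rule g)

end

lemma Re_preimage_sum: "Re (preimage_sum g \<phi> x) = preimage_sum g (\<lambda>y. Re (\<phi> y)) x"
  by (simp add: preimage_sum_def)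

lemma Im_preimage_sum: "Im (preimage_sum g \<phi> x) = preimage_sum g (\<lambda>y. Im (\<phi> y)) x"
  by (simp add: preimage_sum_def)

theorem corollary1p6:
  fixes f :: "rsphere \<Rightarrow> rsphere" and d :: nat
    and \<mu> :: "rsphere measure" and \<phi> :: "rsphere \<Rightarrow> complex"
  assumes "rational_map d f" and "d \<ge> 2"
    and "FLML_measure d f \<mu>"
    and "integrable \<mu> \<phi>"
  shows "AE x in \<mu>. (\<lambda>n. (1 / of_nat n) * (\<Sum>j<n. preimage_sum (f ^^ j) \<phi> x / of_nat d ^ j))
           \<longlonglongrightarrow> (\<integral>y. \<phi> y \<partial>\<mu>)"
proof -
  obtain p q where "q \<noteq> 0" "coprime p q" "d = max (degree p) (degree q)" "f = ratfun p q"
    using assms(1) by (auto simp: rational_map_def)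
  then interpret ratmap_FLML p q d f \<mu>
    using assms(2,3) by unfold_locales
  \<comment> \<open>The operator acts on real functions. Real scalars pass through Re and Im, which
    splits the complex limit into two real ones.\<close>
  have eq: "(1 / of_nat n) * (\<Sum>j<n. preimage_sum (f ^^ j) \<phi> x / of_nat d ^ j) =
      (1 / real n) *\<^sub>R (\<Sum>j<n. (1 / real d ^ j) *\<^sub>R preimage_sum (f ^^ j) \<phi> x)" for n x
    by (simp add: scaleR_conv_of_real)
  have Re: "AE x in \<mu>. (\<lambda>n. birkhoff_sum n (\<lambda>y. Re (\<phi> y)) x / n) \<longlonglongrightarrow> (\<integral>x. Re (\<phi> x) \<partial>\<mu>)"
    and Im: "AE x in \<mu>. (\<lambda>n. birkhoff_sum n (\<lambda>y. Im (\<phi> y)) x / n) \<longlonglongrightarrow> (\<integral>x. Im (\<phi> x) \<partial>\<mu>)"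
    using assms(4) by (intro averages_AE_tendsto; simp)+
  from Re Im show ?thesis
  proof eventually_elim
    case (elim x)
    then show ?case
      unfolding eq tendsto_complex_iff
      using assms(4) by (simp add: birkhoff_sum_def funpow_transfer Re_preimage_sum Im_preimage_sum)
  qed
qed

end
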